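(* Let $M$ be a proper hypersurface of Euclidean space $\mathbb E^{n+1}$ with induced metric $g$. If $(M,g,\mathbf x^T,\lambda,\mu)$ is a quasi-Yamabe soliton with $\mu\neq 0$ everywhere, then $M$ is a quasi-umbilical hypersurface with $\mathbf x^T$ as its distinguished direction. Moreover, $\mathbf x^T$ is a torse-forming vector field on $M$.
   Context: $(M,g,X,\lambda,\mu)$ is a quasi-Yamabe soliton if $(M,g)$ is a Riemannian manifold, $X$ is a vector field on $M$ (the soliton field), $\lambda$ is a real constant and $\mu$ is a function on $M$ such that $\frac12\mathcal L_X g=(R-\lambda)g+\mu X^\#\otimes X^\#$, where $\mathcal L_X$ is the Lie derivative, $X^\#$ is the 1-form dual to $X$, and $R$ is the scalar curvature of $(M,g)$, with the convention $R=\sum_{1\le i\ne j\le n}K_{ij}$ ($K_{ij}$ the sectional curvature of the plane spanned by $e_i,e_j$ for an orthonormal basis $e_1,\dots,e_n$ of the tangent space). $\mathbf x$ denotes the position vector field of $M$ in $\mathbb E^{n+1}$ (with respect to the origin), and $\mathbf x^T$, $\mathbf x^N$ denote its components tangential and normal to $M$. A Euclidean submanifold $M$ is called proper if both $\mathbf x^T$ and $\mathbf x^N$ are nowhere zero on some dense open subset of $M$. A hypersurface of $\mathbb E^{n+1}$ is called quasi-umbilical if its shape operator has an eigenvalue $\kappa$ of multiplicity $\mathrm{mult}(\kappa)\ge n-1$. On the subset $U$ of $M$ on which $\mathrm{mult}(\kappa)=n-1$, an eigenvector whose eigenvalue has multiplicity one is called a distinguished direction of the quasi-umbilical hypersurface.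 A vector field $v$ on a Riemannian manifold $M$ with Levi-Civita connection $\nabla$ is called torse-forming if $\nabla_Xv=\varphi X+\alpha(X)v$ for all $X\in TM$, for some function $\varphi$ and some 1-form $\alpha$ on $M$. *)

theory Defs
  imports "HOL-Analysis.Analysis"
begin

section \<open>Smooth maps and partial derivatives\<close>

fun Ck_on :: "nat \<Rightarrow> 'b::euclidean_space set \<Rightarrow> ('b \<Rightarrow> 'c::real_normed_vector) \<Rightarrow> bool" where
  "Ck_on 0 S f \<longleftrightarrow> continuous_on S f"
| "Ck_on (Suc k) S f \<longleftrightarrow>
     (\<forall>u\<in>S. f differentiable (at u)) \<and> (\<forall>v. Ck_on k S (\<lambda>u. frechet_derivative f (at u) v))"

text \<open>Derivatives are two-sided, so this is the usual notion for open \<open>S\<close>.\<close>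

definition smooth_on :: "'b::euclidean_space set \<Rightarrow> ('b \<Rightarrow> 'c::real_normed_vector) \<Rightarrow> bool" where
  "smooth_on S f \<longleftrightarrow> (\<forall>k. Ck_on k S f)"

definition pd :: "'n::finite \<Rightarrow> (real^'n \<Rightarrow> 'c::real_normed_vector) \<Rightarrow> real^'n \<Rightarrow> 'c" where
  "pd i f u = frechet_derivative f (at u) (axis i 1)"


section \<open>Riemannian geometry in coordinates\<close>

text \<open>
  Throughout this section \<open>G\<close> is the matrix \<open>(g\<^sub>i\<^sub>j)\<close> of a Riemannian metric on an open subset of
  \<open>\<real>\<^sup>n\<close>, and \<open>X\<close> is the vector field with components \<open>X\<^sup>i\<close>.
\<close>

definition ip :: "real^'n^'n \<Rightarrow> real^'n \<Rightarrow> real^'n \<Rightarrow> real" where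
  "ip A a b = a \<bullet> (A *v b)"

definition christoffel :: "(real^'n \<Rightarrow> real^'n^'n) \<Rightarrow> real^'n \<Rightarrow> 'n::finite \<Rightarrow> 'n \<Rightarrow> 'n \<Rightarrow> real" where
  "christoffel G u k i j = (1/2) * (\<Sum>l\<in>UNIV. matrix_inv (G u) $ k $ l *
     (pd i (\<lambda>w. G w $ j $ l) u + pd j (\<lambda>w. G w $ i $ l) u - pd l (\<lambda>w. G w $ i $ j) u))"

definition cov_deriv ::
    "(real^'n \<Rightarrow> real^'n^'n) \<Rightarrow> (real^'n \<Rightarrow> real^'n) \<Rightarrow> real^'n::finite \<Rightarrow> real^'n \<Rightarrow> real^'n" where
  "cov_deriv G X u a = (\<chi> k. \<Sum>i\<in>UNIV. a $ i *
     (pd i (\<lambda>w. X w $ k) u + (\<Sum>j\<in>UNIV. christoffel G u k i j * X u $ j)))"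

definition lie_deriv_metric ::
    "(real^'n \<Rightarrow> real^'n) \<Rightarrow> (real^'n \<Rightarrow> real^'n^'n) \<Rightarrow> real^'n::finite \<Rightarrow> real^'n^'n" where
  "lie_deriv_metric X G u = (\<chi> i j. \<Sum>k\<in>UNIV.
       X u $ k * pd k (\<lambda>w. G w $ i $ j) u
     + G u $ k $ j * pd i (\<lambda>w. X w $ k) u
     + G u $ i $ k * pd j (\<lambda>w. X w $ k) u)"

text \<open>
  \<open>riemann G u l i j k\<close> is the \<open>l\<close>-th component of \<open>R(\<partial>\<^sub>i, \<partial>\<^sub>j)\<partial>\<^sub>k\<close>, where
  \<open>R(X,Y)Z = \<nabla>\<^sub>X\<nabla>\<^sub>Y Z - \<nabla>\<^sub>Y\<nabla>\<^sub>X Z - \<nabla>\<^sub>[\<^sub>X\<^sub>,\<^sub>Y\<^sub>] Z\<close>.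
\<close>

definition riemann ::
    "(real^'n \<Rightarrow> real^'n^'n) \<Rightarrow> real^'n \<Rightarrow> 'n::finite \<Rightarrow> 'n \<Rightarrow> 'n \<Rightarrow> 'n \<Rightarrow> real" where
  "riemann G u l i j k =
     pd i (\<lambda>w. christoffel G w l j k) u - pd j (\<lambda>w. christoffel G w l i k) u
   + (\<Sum>m\<in>UNIV. christoffel G u l i m * christoffel G u m j k
               - christoffel G u l j m * christoffel G u m i k)"

definition curvature_op ::
    "(real^'n \<Rightarrow> real^'n^'n) \<Rightarrow> real^'n \<Rightarrow> real^'n::finite \<Rightarrow> real^'n \<Rightarrow> real^'n \<Rightarrow> real^'n" where
  "curvature_op G u a b c =
     (\<chi> l. \<Sum>i\<in>UNIV. \<Sum>j\<in>UNIV. \<Sum>k\<in>UNIV. riemann G u l i j k * a $ i * b $ j * c $ k)"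

definition sectional ::
    "(real^'n \<Rightarrow> real^'n^'n) \<Rightarrow> real^'n \<Rightarrow> real^'n::finite \<Rightarrow> real^'n \<Rightarrow> real" where
  "sectional G u a b = ip (G u) (curvature_op G u a b b) a /
     (ip (G u) a a * ip (G u) b b - (ip (G u) a b)\<^sup>2)"

definition orthonormal_frame :: "real^'n^'n \<Rightarrow> ('n::finite \<Rightarrow> real^'n) \<Rightarrow> bool" where
  "orthonormal_frame A e \<longleftrightarrow> (\<forall>i j. ip A (e i) (e j) = (if i = j then 1 else 0))"

text \<open>The sum does not depend on the orthonormal frame selected by \<open>SOME\<close>.\<close>

definition scalar_curv_coord :: "(real^'n \<Rightarrow> real^'n^'n) \<Rightarrow> real^'n::finite \<Rightarrow> real" where
  "scalar_curv_coord G u = (let e = (SOME e. orthonormal_frame (G u) e) in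
     \<Sum>i\<in>UNIV. \<Sum>j\<in>UNIV - {i}. sectional G u (e i) (e j))"


section \<open>Immersed hypersurfaces\<close>

text \<open>
  Here \<open>n = CARD('n)\<close>, and \<open>real^('n + 1)\<close> is Euclidean \<open>(n+1)\<close>-space. A hypersurface is given by a
  Hausdorff second countable space \<open>M\<close> with a map \<open>x\<close> into Euclidean space (its position vector),
  which need not be injective; an embedded hypersurface is the case where \<open>x\<close> is the inclusion.

  No atlas has to be supplied: the local parametrizations \<open>\<psi>\<close> for which \<open>x \<circ> \<psi>\<close> is a smooth
  immersion have smooth transition maps, because \<open>x\<close> is locally injective with a smooth local
  inverse on its image. They form the unique smooth structure that makes \<open>x\<close> an immersion.

  Tangent vectors of \<open>M\<close> at \<open>p\<close> are identified with their images under \<open>dx\<close>, so vector fields on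
  \<open>M\<close> are maps from \<open>M\<close> into Euclidean space. All tensors are read in local parametrizations.
\<close>

definition local_param ::
    "'m::topological_space set \<Rightarrow> ('m \<Rightarrow> real^('n::finite + 1)) \<Rightarrow> (real^'n) set \<Rightarrow> (real^'n \<Rightarrow> 'm) \<Rightarrow> bool"
  where
  "local_param M x D \<psi> \<longleftrightarrow>
     open D \<and> openin (top_of_set M) (\<psi> ` D) \<and> (\<exists>\<psi>'. homeomorphism D (\<psi> ` D) \<psi> \<psi>') \<and>
     smooth_on D (x \<circ> \<psi>) \<and> (\<forall>u\<in>D. inj (frechet_derivative (x \<circ> \<psi>) (at u)))"

definition param_at ::
    "'m::topological_space set \<Rightarrow> ('m \<Rightarrow> real^('n::finite + 1)) \<Rightarrow> 'm \<Rightarrow>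
     (real^'n) set \<Rightarrow> (real^'n \<Rightarrow> 'm) \<Rightarrow> real^'n \<Rightarrow> bool" where
  "param_at M x p D \<psi> u \<longleftrightarrow> local_param M x D \<psi> \<and> u \<in> D \<and> \<psi> u = p"

definition hypersurface ::
    "'m::{t2_space,second_countable_topology} set \<Rightarrow> ('m \<Rightarrow> real^('n::finite + 1)) \<Rightarrow> bool" where
  "hypersurface M x \<longleftrightarrow> (\<forall>p\<in>M. \<exists>D \<psi> u. param_at M x p D \<psi> u)"

definition smooth_fun ::
    "'m::topological_space set \<Rightarrow> ('m \<Rightarrow> real^('n::finite + 1)) \<Rightarrow> ('m \<Rightarrow> real) \<Rightarrow> bool" where
  "smooth_fun M x F \<longleftrightarrow> (\<forall>D \<psi>. local_param M x D \<psi> \<longrightarrow> smooth_on D (F \<circ> \<psi>))"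

definition tangent_space ::
    "'m::topological_space set \<Rightarrow> ('m \<Rightarrow> real^('n::finite + 1)) \<Rightarrow> 'm \<Rightarrow> (real^('n + 1)) set" where
  "tangent_space M x p =
     {frechet_derivative (x \<circ> \<psi>) (at u) a | D \<psi> u a. param_at M x p D \<psi> u}"

definition coord_field ::
    "('m \<Rightarrow> real^('n::finite + 1)) \<Rightarrow> (real^'n \<Rightarrow> 'm) \<Rightarrow> ('m \<Rightarrow> real^('n + 1)) \<Rightarrow> real^'n \<Rightarrow> real^'n" where
  "coord_field x \<psi> X u = (THE a. frechet_derivative (x \<circ> \<psi>) (at u) a = X (\<psi> u))"

definition vector_field ::
    "'m::topological_space set \<Rightarrow> ('m \<Rightarrow> real^('n::finite + 1)) \<Rightarrow> ('m \<Rightarrow> real^('n + 1)) \<Rightarrow> bool" where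
  "vector_field M x X \<longleftrightarrow> (\<forall>p\<in>M. X p \<in> tangent_space M x p) \<and>
     (\<forall>D \<psi>. local_param M x D \<psi> \<longrightarrow> smooth_on D (coord_field x \<psi> X))"

definition one_form ::
    "'m::topological_space set \<Rightarrow> ('m \<Rightarrow> real^('n::finite + 1)) \<Rightarrow>
     ('m \<Rightarrow> real^('n + 1) \<Rightarrow> real) \<Rightarrow> bool" where
  "one_form M x \<alpha> \<longleftrightarrow>
     (\<forall>p\<in>M. \<forall>v\<in>tangent_space M x p. \<forall>w\<in>tangent_space M x p. \<forall>a b.
        \<alpha> p (a *\<^sub>R v + b *\<^sub>R w) = a * \<alpha> p v + b * \<alpha> p w) \<and>
     (\<forall>D \<psi>. local_param M x D \<psi> \<longrightarrow> (\<forall>i. smooth_on D (\<lambda>u. \<alpha> (\<psi> u) (pd i (x \<circ> \<psi>) u))))"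


section \<open>Riemannian metrics and quasi-Yamabe solitons\<close>

text \<open>Only the values of \<open>g p\<close> on tangent vectors at \<open>p\<close> matter.\<close>

type_synonym ('m, 'n) metric = "'m \<Rightarrow> real^('n + 1) \<Rightarrow> real^('n + 1) \<Rightarrow> real"

definition metric_matrix ::
    "('m \<Rightarrow> real^('n::finite + 1)) \<Rightarrow> ('m, 'n) metric \<Rightarrow> (real^'n \<Rightarrow> 'm) \<Rightarrow> real^'n \<Rightarrow> real^'n^'n" where
  "metric_matrix x g \<psi> u = (\<chi> i j. g (\<psi> u) (pd i (x \<circ> \<psi>) u) (pd j (x \<circ> \<psi>) u))"

definition riemannian_metric ::
    "'m::topological_space set \<Rightarrow> ('m \<Rightarrow> real^('n::finite + 1)) \<Rightarrow> ('m, 'n) metric \<Rightarrow> bool" where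
  "riemannian_metric M x g \<longleftrightarrow>
     (\<forall>p\<in>M. \<forall>v\<in>tangent_space M x p. \<forall>w\<in>tangent_space M x p.
        g p v w = g p w v \<and> (v \<noteq> 0 \<longrightarrow> g p v v > 0) \<and>
        (\<forall>z\<in>tangent_space M x p. \<forall>a b. g p (a *\<^sub>R v + b *\<^sub>R w) z = a * g p v z + b * g p w z)) \<and>
     (\<forall>D \<psi>. local_param M x D \<psi> \<longrightarrow> (\<forall>i j. smooth_on D (\<lambda>u. metric_matrix x g \<psi> u $ i $ j)))"

definition induced_metric :: "('m, 'n::finite) metric" where
  "induced_metric = (\<lambda>p v w. v \<bullet> w)"

text \<open>All parametrizations at \<open>p\<close> give the same value.\<close>

definition scalar_curvature ::
    "'m::topological_space set \<Rightarrow> ('m \<Rightarrow> real^('n::finite + 1)) \<Rightarrow> ('m, 'n) metric \<Rightarrow> 'm \<Rightarrow> real" where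
  "scalar_curvature M x g p = (THE r. \<forall>D \<psi> u. param_at M x p D \<psi> u \<longrightarrow>
     r = scalar_curv_coord (metric_matrix x g \<psi>) u)"

text \<open>The components of the 1-form dual to \<open>X\<close> are \<open>X\<^sub>i = \<Sum>\<^sub>k g\<^sub>i\<^sub>k X\<^sup>k\<close>.\<close>

definition quasi_yamabe_soliton ::
    "'m::topological_space set \<Rightarrow> ('m \<Rightarrow> real^('n::finite + 1)) \<Rightarrow> ('m, 'n) metric \<Rightarrow>
     ('m \<Rightarrow> real^('n + 1)) \<Rightarrow> real \<Rightarrow> ('m \<Rightarrow> real) \<Rightarrow> bool" where
  "quasi_yamabe_soliton M x g X l \<mu> \<longleftrightarrow>
     riemannian_metric M x g \<and> vector_field M x X \<and> smooth_fun M x \<mu> \<and>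
     (\<forall>p\<in>M. \<forall>D \<psi> u. param_at M x p D \<psi> u \<longrightarrow>
        (let G = metric_matrix x g \<psi>; V = coord_field x \<psi> X in
         \<forall>i j. (1/2) * lie_deriv_metric V G u $ i $ j =
           (scalar_curvature M x g p - l) * G u $ i $ j + \<mu> p * ((G u *v V u) $ i * (G u *v V u) $ j)))"

definition torse_forming ::
    "'m::topological_space set \<Rightarrow> ('m \<Rightarrow> real^('n::finite + 1)) \<Rightarrow> ('m, 'n) metric \<Rightarrow>
     ('m \<Rightarrow> real^('n + 1)) \<Rightarrow> bool" where
  "torse_forming M x g v \<longleftrightarrow> vector_field M x v \<and>
     (\<exists>\<phi> \<alpha>. smooth_fun M x \<phi> \<and> one_form M x \<alpha> \<and>
       (\<forall>p\<in>M. \<forall>D \<psi> u a. param_at M x p D \<psi> u \<longrightarrow>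
          cov_deriv (metric_matrix x g \<psi>) (coord_field x \<psi> v) u a =
            \<phi> p *\<^sub>R a + \<alpha> p (frechet_derivative (x \<circ> \<psi>) (at u) a) *\<^sub>R coord_field x \<psi> v u))"


section \<open>Extrinsic geometry\<close>

definition tangential_part ::
    "'m::topological_space set \<Rightarrow> ('m \<Rightarrow> real^('n::finite + 1)) \<Rightarrow> 'm \<Rightarrow> real^('n + 1)" where
  "tangential_part M x p =
     (THE y. y \<in> tangent_space M x p \<and> (\<forall>v\<in>tangent_space M x p. (x p - y) \<bullet> v = 0))"

definition normal_part ::
    "'m::topological_space set \<Rightarrow> ('m \<Rightarrow> real^('n::finite + 1)) \<Rightarrow> 'm \<Rightarrow> real^('n + 1)" where
  "normal_part M x p = x p - tangential_part M x p"

definition proper_submanifold ::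
    "'m::topological_space set \<Rightarrow> ('m \<Rightarrow> real^('n::finite + 1)) \<Rightarrow> bool" where
  "proper_submanifold M x \<longleftrightarrow>
     (\<exists>W. openin (top_of_set M) W \<and> M \<subseteq> closure W \<and>
          (\<forall>p\<in>W. tangential_part M x p \<noteq> 0 \<and> normal_part M x p \<noteq> 0))"

definition unit_normal ::
    "'m::topological_space set \<Rightarrow> ('m \<Rightarrow> real^('n::finite + 1)) \<Rightarrow> 'm \<Rightarrow> real^('n + 1) \<Rightarrow> bool" where
  "unit_normal M x p \<nu> \<longleftrightarrow> norm \<nu> = 1 \<and> (\<forall>v\<in>tangent_space M x p. \<nu> \<bullet> v = 0)"

definition second_fundamental_form ::
    "('m \<Rightarrow> real^('n::finite + 1)) \<Rightarrow> (real^'n \<Rightarrow> 'm) \<Rightarrow> real^('n + 1) \<Rightarrow> real^'n \<Rightarrow> real^'n^'n" where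
  "second_fundamental_form x \<psi> \<nu> u = (\<chi> i j. pd i (pd j (x \<circ> \<psi>)) u \<bullet> \<nu>)"

text \<open>
  The matrix, in the basis \<open>\<partial>\<^sub>i\<close>, of the shape operator \<open>A\<^sub>\<nu>\<close> determined by
  \<open>g(A\<^sub>\<nu> v, w) = \<langle>h(v, w), \<nu>\<rangle>\<close>. Replacing \<open>\<nu>\<close> by \<open>-\<nu>\<close> changes its sign, changing the
  parametrization conjugates it, so multiplicities of eigenvalues depend on neither choice.
\<close>

definition shape_operator ::
    "('m \<Rightarrow> real^('n::finite + 1)) \<Rightarrow> (real^'n \<Rightarrow> 'm) \<Rightarrow> real^('n + 1) \<Rightarrow> real^'n \<Rightarrow> real^'n^'n" where
  "shape_operator x \<psi> \<nu> u =
     matrix_inv (metric_matrix x induced_metric \<psi> u) ** second_fundamental_form x \<psi> \<nu> u"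

text \<open>The shape operator is self-adjoint, so the geometric multiplicity is the algebraic one.\<close>

definition eig_mult :: "real^'n^'n \<Rightarrow> real \<Rightarrow> nat" where
  "eig_mult A \<kappa> = dim {w. A *v w = \<kappa> *\<^sub>R w}"

definition eigenvalue :: "real^'n^'n \<Rightarrow> real \<Rightarrow> bool" where
  "eigenvalue A \<kappa> \<longleftrightarrow> (\<exists>w. w \<noteq> 0 \<and> A *v w = \<kappa> *\<^sub>R w)"

definition quasi_umbilical ::
    "'m::topological_space set \<Rightarrow> ('m \<Rightarrow> real^('n::finite + 1)) \<Rightarrow> bool" where
  "quasi_umbilical M x \<longleftrightarrow>
     (\<forall>p\<in>M. \<forall>D \<psi> u \<nu>. param_at M x p D \<psi> u \<and> unit_normal M x p \<nu> \<longrightarrow>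
        (\<exists>\<kappa>. eigenvalue (shape_operator x \<psi> \<nu> u) \<kappa> \<and>
             eig_mult (shape_operator x \<psi> \<nu> u) \<kappa> \<ge> CARD('n) - 1))"

text \<open>
  For \<open>n = 1\<close> the locus is empty, since an eigenvalue has multiplicity at least 1. For \<open>n = 2\<close> it
  consists of the non-umbilical points, and there both eigenvalues are simple.
\<close>

definition quasi_umbilical_locus ::
    "'m::topological_space set \<Rightarrow> ('m \<Rightarrow> real^('n::finite + 1)) \<Rightarrow> 'm set" where
  "quasi_umbilical_locus M x =
     {p \<in> M. \<forall>D \<psi> u \<nu>. param_at M x p D \<psi> u \<and> unit_normal M x p \<nu> \<longrightarrow>
        (\<exists>\<kappa>. eigenvalue (shape_operator x \<psi> \<nu> u) \<kappa> \<and>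
             eig_mult (shape_operator x \<psi> \<nu> u) \<kappa> = CARD('n) - 1)}"

definition distinguished_direction ::
    "'m::topological_space set \<Rightarrow> ('m \<Rightarrow> real^('n::finite + 1)) \<Rightarrow> ('m \<Rightarrow> real^('n + 1)) \<Rightarrow> bool" where
  "distinguished_direction M x X \<longleftrightarrow>
     (\<forall>p\<in>quasi_umbilical_locus M x. X p \<in> tangent_space M x p \<and> X p \<noteq> 0 \<and>
       (\<forall>D \<psi> u \<nu>. param_at M x p D \<psi> u \<and> unit_normal M x p \<nu> \<longrightarrow>
          (\<exists>\<kappa>. shape_operator x \<psi> \<nu> u *v coord_field x \<psi> X u = \<kappa> *\<^sub>R coord_field x \<psi> X u \<and>
               eig_mult (shape_operator x \<psi> \<nu> u) \<kappa> = 1)))"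

end

theory Submission
  imports Defs
begin

text \<open>
  In a local parametrization write the position vector as \<open>f = T + N\<close> with \<open>T = df V\<close> tangential and
  \<open>N\<close> normal. Since the position vector has the identity as its derivative, differentiating
  \<open>\<langle>N, \<partial>\<^sub>j f\<rangle> = 0\<close> gives \<open>\<langle>\<partial>\<^sub>i T, \<partial>\<^sub>j f\<rangle> = g\<^sub>i\<^sub>j + \<langle>N, \<partial>\<^sub>i \<partial>\<^sub>j f\<rangle>\<close>. The left-hand side is
  \<open>g(\<nabla>\<^sub>i V, \<partial>\<^sub>j)\<close>, and as the right-hand side is symmetric, it is also half the Lie derivative of \<open>g\<close>.
  With \<open>\<phi> = R - \<lambda>\<close> the soliton equation therefore says two things:

  \<^item> \<open>\<nabla>\<^sub>a V = \<phi> a + \<mu> \<langle>T, a\<rangle> V\<close> (lemma \<open>cov_deriv_V\<close>), so \<open>T\<close> is torse-forming;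
  \<^item> \<open>\<langle>N, h\<rangle> = (\<phi> - 1) g + \<mu> T\<^sup># \<otimes> T\<^sup>#\<close> for the second fundamental form \<open>h\<close> (lemma
    \<open>N_inner_second\<close>). Where \<open>N \<noteq> 0\<close>, the shape operator is thus a scalar plus a rank-one operator
    with image in the line of \<open>T\<close> (lemma \<open>shape_operator_rank_one\<close>); if also \<open>T \<noteq> 0\<close>, its eigenspaces
    are this line and its orthogonal complement.

  The function \<open>\<phi>\<close> is smooth because a diagonal component of the soliton equation can be solved for
  it. For a curve, quasi-umbilicity is immediate and the locus of eigenvalue multiplicity \<open>n - 1 = 0\<close>
  is empty, so only the torse-forming property has content.

  In dimension at least two it remains to see that \<open>N\<close> vanishes nowhere. If \<open>N = 0\<close> at a point, a
  tangent vector orthogonal to \<open>T\<close> shows \<open>\<phi> = 1\<close>, and \<open>T\<close> itself then shows \<open>\<mu> \<bar>T\<bar>\<^sup>4 = 0\<close>, so the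
  point lies at the origin. Approach such a point along a ray with direction \<open>d\<close>. There
  \<open>V\<close> is \<open>t d\<close> to first order while \<open>\<bar>N\<bar>\<close> is at most \<open>C t\<^sup>2\<close>, so in the equation for \<open>h\<close> in the unit
  direction \<open>N / \<bar>N\<bar>\<close> the coefficient \<open>\<mu> \<bar>T\<bar>\<^sup>2 / \<bar>N\<bar>\<close> of the rank-one term stays away from zero.
  For a limit of these unit normals, \<open>h(d, z) = 0\<close> whenever \<open>d\<close> and \<open>z\<close> are orthogonal, but
  \<open>h(d, d) \<noteq> h(z, z)\<close> if they are orthonormal (lemma \<open>blow_up_second\<close>). For orthonormal \<open>e\<close> and \<open>w\<close>
  the first conclusion applied to \<open>e + w\<close> and \<open>e - w\<close> gives \<open>h(e, e) = h(w, w)\<close>, contradicting the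
  second (lemma \<open>f_nonzero\<close>).

  All this is read in one parametrization. That tangent spaces, and hence \<open>T\<close>, are the same in every
  parametrization is lemma \<open>tangent_space_param\<close>.
\<close>

section \<open>Smooth functions\<close>

lemma smooth_on_differentiable:
  "smooth_on S f \<Longrightarrow> u \<in> S \<Longrightarrow> f differentiable (at u)"
  unfolding smooth_on_def by (metis Ck_on.simps(2))

lemma smooth_on_frechet_derivative:
  "smooth_on S f \<Longrightarrow> smooth_on S (\<lambda>u. frechet_derivative f (at u) v)"
  unfolding smooth_on_def by (metis Ck_on.simps(2))

lemma smooth_on_pd: "smooth_on S f \<Longrightarrow> smooth_on S (pd i f)"
  using smooth_on_frechet_derivative[of S f "axis i 1"] by (simp add: pd_def[abs_def])

lemma smooth_on_continuous: "smooth_on S f \<Longrightarrow> continuous_on S f"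
  unfolding smooth_on_def by (metis Ck_on.simps(1))

lemma has_derivative_frechet:
  "f differentiable (at u) \<Longrightarrow> (f has_derivative frechet_derivative f (at u)) (at u)"
  by (simp add: frechet_derivative_works)

lemma Ck_on_cong:
  assumes "open S" "\<And>u. u \<in> S \<Longrightarrow> f u = g u" "Ck_on k S f"
  shows "Ck_on k S g"
  using assms
proof (induction k arbitrary: f g)
  case 0
  then show ?case by (metis Ck_on.simps(1) continuous_on_cong)
next
  case (Suc k)
  have d: "(g has_derivative frechet_derivative f (at u)) (at u)" if "u \<in> S" for u
  proof (rule has_derivative_transform_within_open[OF _ \<open>open S\<close> that])
    show "(f has_derivative frechet_derivative f (at u)) (at u)"
      using Suc.prems(3) that by (simp add: has_derivative_frechet)
  qed (use Suc.prems in auto)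
  have "Ck_on k S (\<lambda>u. frechet_derivative g (at u) v)" for v
  proof (rule Suc.IH[OF \<open>open S\<close>])
    show "Ck_on k S (\<lambda>u. frechet_derivative f (at u) v)" using Suc.prems(3) by simp
    show "frechet_derivative f (at u) v = frechet_derivative g (at u) v" if "u \<in> S" for u
      using frechet_derivative_at[OF d[OF that]] by simp
  qed
  then show ?case using d by (auto simp: differentiable_def)
qed

lemma smooth_on_cong:
  "open S \<Longrightarrow> (\<And>u. u \<in> S \<Longrightarrow> f u = g u) \<Longrightarrow> smooth_on S f \<Longrightarrow> smooth_on S g"
  unfolding smooth_on_def using Ck_on_cong by blast

text \<open>This turns a differentiation rule that holds on the open set into the step of an induction on
  the order of differentiability.\<close>

lemma Ck_on_SucI:
  assumes "open S" and d: "\<And>u. u \<in> S \<Longrightarrow> (f has_derivative F u) (at u)"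
    and "\<And>v. Ck_on k S (\<lambda>u. F u v)"
  shows "Ck_on (Suc k) S f"
proof -
  have "Ck_on k S (\<lambda>u. frechet_derivative f (at u) v)" for v
    by (rule Ck_on_cong[OF assms(1) _ assms(3)[of v]]) (metis d frechet_derivative_at)
  then show ?thesis using d by (auto simp: differentiable_def)
qed

lemma Ck_on_add:
  assumes "open S" "Ck_on k S f" "Ck_on k S g"
  shows "Ck_on k S (\<lambda>u. f u + g u)"
  using assms
proof (induction k arbitrary: f g)
  case 0
  then show ?case by (simp add: continuous_on_add)
next
  case (Suc k)
  show ?case
    by (rule Ck_on_SucI[OF \<open>open S\<close> has_derivative_add[OF has_derivative_frechet has_derivative_frechet]])
      (use Suc in auto)
qed

lemma Ck_on_linear:
  assumes "open S" "bounded_linear L" "Ck_on k S f"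
  shows "Ck_on k S (\<lambda>u. L (f u))"
  using assms
proof (induction k arbitrary: f)
  case 0
  then show ?case by (simp add: linear_continuous_on_compose bounded_linear.linear bounded_linear.continuous_on)
next
  case (Suc k)
  show ?case
    by (rule Ck_on_SucI[OF \<open>open S\<close> bounded_linear.has_derivative[OF Suc.prems(2) has_derivative_frechet]])
      (use Suc in auto)
qed

lemma smooth_on_add:
  "open S \<Longrightarrow> smooth_on S f \<Longrightarrow> smooth_on S g \<Longrightarrow> smooth_on S (\<lambda>u. f u + g u)"
  unfolding smooth_on_def using Ck_on_add by blast

lemma smooth_on_linear:
  "open S \<Longrightarrow> bounded_linear L \<Longrightarrow> smooth_on S f \<Longrightarrow> smooth_on S (\<lambda>u. L (f u))"
  unfolding smooth_on_def using Ck_on_linear by blast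

lemma smooth_on_const: "open S \<Longrightarrow> smooth_on S (\<lambda>u. c)"
proof -
  assume "open S"
  have "Ck_on k S (\<lambda>u. c)" for k
  proof (induction k arbitrary: c)
    case (Suc k)
    show ?case
      by (rule Ck_on_SucI[OF \<open>open S\<close> has_derivative_const]) (rule Suc)
  qed simp
  then show ?thesis by (simp add: smooth_on_def)
qed

lemma smooth_on_diff:
  assumes "open S" "smooth_on S f" "smooth_on S g"
  shows "smooth_on S (\<lambda>u. f u - g u)"
  using smooth_on_add[OF assms(1,2) smooth_on_linear[OF assms(1) _ assms(3), of uminus]]
  by (simp add: bounded_linear_minus bounded_linear_ident)

lemma smooth_on_sum:
  assumes "open S" "finite I" "\<And>i. i \<in> I \<Longrightarrow> smooth_on S (f i)"
  shows "smooth_on S (\<lambda>u. \<Sum>i\<in>I. f i u)"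
  using assms(2,3) by (induction I) (auto intro: smooth_on_add smooth_on_const assms(1))

lemma smooth_on_mult:
  fixes f g :: "'a::euclidean_space \<Rightarrow> real"
  assumes "open S" "smooth_on S f" "smooth_on S g"
  shows "smooth_on S (\<lambda>u. f u * g u)"
proof -
  have "Ck_on k S (\<lambda>u. f u * g u)" for k
    using assms(2,3)
  proof (induction k arbitrary: f g)
    case 0
    then show ?case by (simp add: continuous_on_mult smooth_on_continuous)
  next
    case (Suc k)
    show ?case
      by (rule Ck_on_SucI[OF \<open>open S\<close> has_derivative_mult[OF has_derivative_frechet has_derivative_frechet]])
        (auto intro!: Ck_on_add \<open>open S\<close> Suc smooth_on_frechet_derivative smooth_on_differentiable)
  qed
  then show ?thesis by (simp add: smooth_on_def)
qed

text \<open>The quotient rule expresses a directional derivative of a quotient of smooth functions as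
  another such quotient, which makes the induction on the order of differentiability close.\<close>

lemma smooth_on_divide:
  fixes f g :: "'a::euclidean_space \<Rightarrow> real"
  assumes "open S" "smooth_on S f" "smooth_on S g" "\<And>u. u \<in> S \<Longrightarrow> g u \<noteq> 0"
  shows "smooth_on S (\<lambda>u. f u / g u)"
proof -
  have "Ck_on k S (\<lambda>u. f u / g u)" for k
    using assms(2-4)
  proof (induction k arbitrary: f g)
    case 0
    then show ?case by (simp add: continuous_on_divide smooth_on_continuous)
  next
    case (Suc k)
    show ?case
      by (rule Ck_on_SucI[OF \<open>open S\<close> has_derivative_divide'[OF has_derivative_frechet has_derivative_frechet]])
        (use Suc.prems in \<open>auto intro!: Suc.IH smooth_on_mult smooth_on_diff \<open>open S\<close>
          smooth_on_frechet_derivative smooth_on_differentiable\<close>)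
  qed
  then show ?thesis by (simp add: smooth_on_def)
qed

section \<open>Difference quotients and symmetry of second derivatives\<close>

lemma limit_of_eventually_const:
  fixes X :: "nat \<Rightarrow> 'a::t2_space"
  assumes "X \<longlonglongrightarrow> l" "eventually (\<lambda>k. X k = c) sequentially"
  shows "l = c"
  using LIMSEQ_unique[OF assms(1) tendsto_eventually[OF assms(2)]] .

lemma tendsto_difference_quotient:
  fixes h :: "'a::real_normed_vector \<Rightarrow> 'b::real_normed_vector" and t :: "nat \<Rightarrow> real"
  assumes h: "(h has_derivative h') (at u)" and "d \<noteq> 0"
    and t: "t \<longlonglongrightarrow> 0" "\<And>k. t k \<noteq> 0"
  shows "(\<lambda>k. (h (u + t k *\<^sub>R d) - h u) /\<^sub>R t k) \<longlonglongrightarrow> h' d"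
proof -
  have lin: "linear h'" using h by (rule has_derivative_linear)
  have td: "(\<lambda>k. t k *\<^sub>R d) \<longlonglongrightarrow> 0" using tendsto_scaleR[OF t(1) tendsto_const[of d]] by simp
  have lim: "filterlim (\<lambda>k. t k *\<^sub>R d) (at 0) sequentially"
    using td t(2) \<open>d \<noteq> 0\<close> by (intro filterlim_atI) auto
  have "(\<lambda>k. norm (h (u + t k *\<^sub>R d) - h u - h' (t k *\<^sub>R d)) / norm (t k *\<^sub>R d)) \<longlonglongrightarrow> 0"
    by (rule filterlim_compose[OF conjunct2[OF h[unfolded has_derivative_at]] lim])
  from tendsto_mult_left[OF this, of "norm d"]
  have "(\<lambda>k. norm d * (norm (h (u + t k *\<^sub>R d) - h u - h' (t k *\<^sub>R d)) / norm (t k *\<^sub>R d))) \<longlonglongrightarrow> 0"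
    by simp
  moreover have "norm d * (norm (h (u + t k *\<^sub>R d) - h u - h' (t k *\<^sub>R d)) / norm (t k *\<^sub>R d)) =
      norm ((h (u + t k *\<^sub>R d) - h u) /\<^sub>R t k - h' d)" for k
  proof -
    have "(h (u + t k *\<^sub>R d) - h u) /\<^sub>R t k - h' d =
        (h (u + t k *\<^sub>R d) - h u - h' (t k *\<^sub>R d)) /\<^sub>R t k"
      using t(2)[of k] by (simp add: linear_cmul[OF lin] scaleR_right_diff_distrib)
    then show ?thesis using \<open>d \<noteq> 0\<close> by (simp add: divide_inverse)
  qed
  ultimately have "(\<lambda>k. norm ((h (u + t k *\<^sub>R d) - h u) /\<^sub>R t k - h' d)) \<longlonglongrightarrow> 0" by simp
  then show ?thesis by (simp add: tendsto_norm_zero_iff LIM_zero_iff)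
qed

text \<open>Applying the mean value theorem twice to the second difference of a function over a
  parallelogram yields a mixed second derivative, whose order is that of the two applications.\<close>

lemma second_difference_mvt:
  fixes f :: "'a::real_normed_vector \<Rightarrow> real"
  assumes sub: "ball u r \<subseteq> S" and r: "norm a + norm b < r"
    and f: "\<And>w. w \<in> S \<Longrightarrow> f differentiable (at w)"
    and fa: "\<And>w. w \<in> S \<Longrightarrow> (\<lambda>w. frechet_derivative f (at w) a) differentiable (at w)"
  shows "\<exists>\<xi>\<in>ball u r. f (u + a + b) - f (u + a) - f (u + b) + f u =
           frechet_derivative (\<lambda>w. frechet_derivative f (at w) a) (at \<xi>) b"
proof -
  have inb: "u + s *\<^sub>R a + t *\<^sub>R b \<in> ball u r" if "0 \<le> s" "s \<le> 1" "0 \<le> t" "t \<le> 1" for s t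
  proof -
    have "norm (s *\<^sub>R a + t *\<^sub>R b) \<le> s * norm a + t * norm b"
      using norm_triangle_ineq[of "s *\<^sub>R a" "t *\<^sub>R b"] that by simp
    also have "\<dots> \<le> norm a + norm b"
      using that by (intro add_mono mult_left_le_one_le) auto
    finally have "norm (- (s *\<^sub>R a + t *\<^sub>R b)) < r" using r by (simp only: norm_minus_cancel)
    then show ?thesis by (simp add: dist_norm algebra_simps)
  qed
  let ?D = "\<lambda>w. frechet_derivative f (at w)"
  let ?E = "\<lambda>w. frechet_derivative (\<lambda>w. ?D w a) (at w)"
  define h where "h s = f (u + s *\<^sub>R a + b) - f (u + s *\<^sub>R a)" for s
  have dh: "(h has_real_derivative (?D (u + s *\<^sub>R a + b) a - ?D (u + s *\<^sub>R a) a)) (at s)"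
    if "0 \<le> s" "s \<le> 1" for s
  proof -
    have 1: "((\<lambda>s. f (u + s *\<^sub>R a + b)) has_derivative (\<lambda>y. ?D (u + s *\<^sub>R a + b) (y *\<^sub>R a))) (at s)"
      by (rule has_derivative_compose[where g = f and f = "\<lambda>s. u + s *\<^sub>R a + b"])
        (use inb[of s 1] that sub in
          \<open>auto intro!: derivative_eq_intros has_derivative_frechet f\<close>)
    have 2: "((\<lambda>s. f (u + s *\<^sub>R a)) has_derivative (\<lambda>y. ?D (u + s *\<^sub>R a) (y *\<^sub>R a))) (at s)"
      by (rule has_derivative_compose[where g = f and f = "\<lambda>s. u + s *\<^sub>R a"])
        (use inb[of s 0] that sub in
          \<open>auto intro!: derivative_eq_intros has_derivative_frechet f\<close>)
    have lin: "linear (?D w)" if "w \<in> ball u r" for w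
      using f sub that by (intro linear_frechet_derivative) auto
    have "?D (u + s *\<^sub>R a + b) (y *\<^sub>R a) - ?D (u + s *\<^sub>R a) (y *\<^sub>R a) =
        (?D (u + s *\<^sub>R a + b) a - ?D (u + s *\<^sub>R a) a) * y" for y
      using linear_cmul[OF lin, of "u + s *\<^sub>R a + b" y a] linear_cmul[OF lin, of "u + s *\<^sub>R a" y a]
        inb[of s 1] inb[of s 0] that by (simp add: algebra_simps)
    then show ?thesis
      using has_derivative_diff[OF 1 2] by (simp add: h_def[abs_def] has_field_derivative_def)
  qed
  obtain s where s: "0 < s" "s < 1" and hs: "h 1 - h 0 = (1 - 0) * (?D (u + s *\<^sub>R a + b) a - ?D (u + s *\<^sub>R a) a)"
    using MVT2[of 0 1 h, OF _ dh] by auto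
  define k where "k t = ?D (u + s *\<^sub>R a + t *\<^sub>R b) a" for t
  have dk: "(k has_real_derivative ?E (u + s *\<^sub>R a + t *\<^sub>R b) b) (at t)"
    if "0 \<le> t" "t \<le> 1" for t
  proof -
    have w: "u + s *\<^sub>R a + t *\<^sub>R b \<in> S" using inb[of s t] s that sub by auto
    have "(k has_derivative (\<lambda>y. ?E (u + s *\<^sub>R a + t *\<^sub>R b) (y *\<^sub>R b))) (at t)"
      unfolding k_def
      by (rule has_derivative_compose[where g = "\<lambda>w. ?D w a" and f = "\<lambda>t. u + s *\<^sub>R a + t *\<^sub>R b"])
        (auto intro!: derivative_eq_intros has_derivative_frechet fa w)
    then show ?thesis
      using linear_cmul[OF linear_frechet_derivative[OF fa[OF w]]]
      by (simp add: has_field_derivative_def mult_commute_abs)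
  qed
  obtain t where t: "0 < t" "t < 1" and kt: "k 1 - k 0 = (1 - 0) * ?E (u + s *\<^sub>R a + t *\<^sub>R b) b"
    using MVT2[of 0 1 k, OF _ dk] by auto
  show ?thesis
  proof (rule bexI)
    show "u + s *\<^sub>R a + t *\<^sub>R b \<in> ball u r" using inb s t by auto
    show "f (u + a + b) - f (u + a) - f (u + b) + f u = ?E (u + s *\<^sub>R a + t *\<^sub>R b) b"
      using hs kt by (simp add: h_def k_def)
  qed
qed

text \<open>If the mixed derivatives differed at \<open>u\<close>, continuity would separate their values on a ball
  around \<open>u\<close>; a small parallelogram contradicts this, as its second difference does not depend on
  the order of its sides.\<close>

lemma symmetric_second_derivative_real:
  fixes f :: "'a::euclidean_space \<Rightarrow> real"
  assumes S: "open S" "u \<in> S" and f: "smooth_on S f"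
  shows "frechet_derivative (\<lambda>w. frechet_derivative f (at w) a) (at u) b =
         frechet_derivative (\<lambda>w. frechet_derivative f (at w) b) (at u) a"
proof (rule ccontr)
  define E where "E a b w = frechet_derivative (\<lambda>w. frechet_derivative f (at w) a) (at w) b" for a b w
  assume "\<not> ?thesis"
  then have pos: "0 < \<bar>E a b u - E b a u\<bar>" by (simp add: E_def)
  have cont: "continuous_on S (\<lambda>w. E a b w)" for a b
    unfolding E_def using f by (intro smooth_on_continuous smooth_on_frechet_derivative)
  let ?e = "\<bar>E a b u - E b a u\<bar> / 2"
  have e: "0 < ?e" using pos by simp
  have "\<exists>d>0. \<forall>w\<in>S. dist w u < d \<longrightarrow> dist (E a b w) (E a b u) < ?e"
    using cont[of a b] S(2) e unfolding continuous_on_iff by blast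
  then obtain d1 where d1: "d1 > 0" "\<And>w. w \<in> S \<Longrightarrow> dist w u < d1 \<Longrightarrow> dist (E a b w) (E a b u) < ?e"
    by blast
  have "\<exists>d>0. \<forall>w\<in>S. dist w u < d \<longrightarrow> dist (E b a w) (E b a u) < ?e"
    using cont[of b a] S(2) e unfolding continuous_on_iff by blast
  then obtain d2 where d2: "d2 > 0" "\<And>w. w \<in> S \<Longrightarrow> dist w u < d2 \<Longrightarrow> dist (E b a w) (E b a u) < ?e"
    by blast
  obtain d3 where d3: "d3 > 0" "ball u d3 \<subseteq> S" using S by (meson open_contains_ball)
  define r where "r = min d1 (min d2 d3)"
  have r: "r > 0" "ball u r \<subseteq> S" using d1 d2 d3 by (auto simp: r_def)
  \<comment> \<open>Both orders produce the second difference over the parallelogram with sides \<open>t a\<close>, \<open>t b\<close>.\<close>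
  define t where "t = r / (norm a + norm b + 1)"
  have t: "t > 0" using r by (simp add: t_def add_nonneg_pos)
  have "t * (norm a + norm b) < t * (norm a + norm b + 1)" using t by simp
  also have "\<dots> = r"
    using add_nonneg_pos[of "norm a + norm b" 1] by (simp add: t_def)
  finally have small: "norm (t *\<^sub>R a) + norm (t *\<^sub>R b) < r" "norm (t *\<^sub>R b) + norm (t *\<^sub>R a) < r"
    using t by (simp_all add: algebra_simps)
  note sm = smooth_on_differentiable[OF f] smooth_on_differentiable[OF smooth_on_frechet_derivative[OF f]]
  obtain \<xi> where \<xi>: "\<xi> \<in> ball u r"
    "f (u + t *\<^sub>R a + t *\<^sub>R b) - f (u + t *\<^sub>R a) - f (u + t *\<^sub>R b) + f u = E (t *\<^sub>R a) (t *\<^sub>R b) \<xi>"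
    using second_difference_mvt[OF r(2) small(1) sm] unfolding E_def by blast
  obtain \<eta> where \<eta>: "\<eta> \<in> ball u r"
    "f (u + t *\<^sub>R b + t *\<^sub>R a) - f (u + t *\<^sub>R b) - f (u + t *\<^sub>R a) + f u = E (t *\<^sub>R b) (t *\<^sub>R a) \<eta>"
    using second_difference_mvt[OF r(2) small(2) sm] unfolding E_def by blast
  have hom: "E (t *\<^sub>R a) (t *\<^sub>R b) w = t * t * E a b w" if w: "w \<in> S" for a b w
  proof -
    have "((\<lambda>w. t *\<^sub>R frechet_derivative f (at w) a) has_derivative
        (\<lambda>v. t *\<^sub>R frechet_derivative (\<lambda>w. frechet_derivative f (at w) a) (at w) v)) (at w)"
      by (intro has_derivative_scaleR_right has_derivative_frechet sm w)
    then have "((\<lambda>w. frechet_derivative f (at w) (t *\<^sub>R a)) has_derivative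
        (\<lambda>v. t *\<^sub>R frechet_derivative (\<lambda>w. frechet_derivative f (at w) a) (at w) v)) (at w)"
      by (rule has_derivative_transform_within_open[OF _ S(1) w])
        (simp add: linear_cmul[OF linear_frechet_derivative[OF sm(1)]])
    note eq = fun_cong[OF frechet_derivative_at[OF this], of "t *\<^sub>R b"]
    show ?thesis
      unfolding E_def using linear_cmul[OF linear_frechet_derivative[OF sm(2)[OF w, of a]], of t b]
      by (simp flip: eq)
  qed
  have "E (t *\<^sub>R a) (t *\<^sub>R b) \<xi> = E (t *\<^sub>R b) (t *\<^sub>R a) \<eta>"
    using \<xi>(2) \<eta>(2) by (simp add: algebra_simps)
  moreover have "\<xi> \<in> S" "\<eta> \<in> S" using \<xi>(1) \<eta>(1) r(2) by auto
  ultimately have "E a b \<xi> = E b a \<eta>"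
    using hom[of \<xi> a b] hom[of \<eta> b a] t by simp
  moreover have "dist (E a b \<xi>) (E a b u) < ?e"
    using \<xi>(1) r(2) by (intro d1(2)) (auto simp: r_def dist_commute)
  moreover have "dist (E b a \<eta>) (E b a u) < ?e"
    using \<eta>(1) r(2) by (intro d2(2)) (auto simp: r_def dist_commute)
  ultimately show False
    unfolding dist_real_def by (smt (verit) field_sum_of_halves)
qed

lemma symmetric_second_derivative:
  fixes f :: "'a::euclidean_space \<Rightarrow> 'b::euclidean_space"
  assumes S: "open S" "u \<in> S" and f: "smooth_on S f"
  shows "frechet_derivative (\<lambda>w. frechet_derivative f (at w) a) (at u) b =
         frechet_derivative (\<lambda>w. frechet_derivative f (at w) b) (at u) a"
proof (rule euclidean_eqI)
  fix c :: 'b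
  define g where "g w = f w \<bullet> c" for w
  have g: "smooth_on S g"
    unfolding g_def by (rule smooth_on_linear[OF S(1) _ f]) (rule bounded_linear_inner_left)
  have comp: "frechet_derivative (\<lambda>w. h w \<bullet> c) (at w) v = frechet_derivative h (at w) v \<bullet> c"
    if "h differentiable (at w)" for h :: "'a \<Rightarrow> 'b" and w v
    using frechet_derivative_at[OF has_derivative_inner_left[OF has_derivative_frechet[OF that], of c]]
    by metis
  have "frechet_derivative (\<lambda>w. frechet_derivative g (at w) a) (at u) b =
      frechet_derivative (\<lambda>w. frechet_derivative f (at w) a) (at u) b \<bullet> c" for a b
  proof -
    have "frechet_derivative (\<lambda>w. frechet_derivative g (at w) a) (at u) =
        frechet_derivative (\<lambda>w. frechet_derivative f (at w) a \<bullet> c) (at u)"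
    proof (rule frechet_derivative_transform_within_open[OF _ S])
      show "(\<lambda>w. frechet_derivative g (at w) a) differentiable (at u)"
        using S g by (blast intro: smooth_on_differentiable smooth_on_frechet_derivative)
      show "frechet_derivative g (at w) a = frechet_derivative f (at w) a \<bullet> c" if "w \<in> S" for w
        using comp[OF smooth_on_differentiable[OF f that]] by (simp add: g_def[abs_def])
    qed
    then show ?thesis
      using comp[OF smooth_on_differentiable[OF smooth_on_frechet_derivative[OF f] S(2)]] by simp
  qed
  then show "frechet_derivative (\<lambda>w. frechet_derivative f (at w) a) (at u) b \<bullet> c =
      frechet_derivative (\<lambda>w. frechet_derivative f (at w) b) (at u) a \<bullet> c"
    using symmetric_second_derivative_real[OF S g] by metis
qed

section \<open>Rank-one perturbations of scalar matrices\<close>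

lemma exists_orthogonal_nonzero:
  fixes b :: "real^'n::finite"
  assumes "2 \<le> CARD('n)"
  obtains w where "w \<noteq> 0" "b \<bullet> w = 0"
proof (cases "b = 0")
  case True
  then show ?thesis using that[of "axis undefined 1"] by simp
next
  case False
  then have "dim {w. b \<bullet> w = 0} \<noteq> 0" using assms by (simp add: dim_hyperplane)
  then have "\<not> {w. b \<bullet> w = 0} \<subseteq> {0}" by (metis dim_eq_0)
  then show ?thesis using that by blast
qed

locale scalar_plus_rank_one =
  fixes A :: "real^'n::finite^'n" and \<kappa> \<sigma> :: real and b V :: "real^'n"
  assumes mult: "A *v w = \<kappa> *\<^sub>R w + (\<sigma> * (b \<bullet> w)) *\<^sub>R V"
begin

lemma eig_mult_ge: "CARD('n) - 1 \<le> eig_mult A \<kappa>"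
proof -
  have "CARD('n) - 1 \<le> dim {w. b \<bullet> w = 0}"
    by (cases "b = 0") (simp_all add: dim_hyperplane dim_UNIV)
  also have "\<dots> \<le> eig_mult A \<kappa>"
    unfolding eig_mult_def by (intro dim_subset) (auto simp: mult)
  finally show ?thesis .
qed

lemma eigenvalue_scalar: "2 \<le> CARD('n) \<Longrightarrow> eigenvalue A \<kappa>"
  using exists_orthogonal_nonzero[of b] unfolding eigenvalue_def
  by (metis add.right_neutral mult mult_zero_right scale_zero_left)

lemma eig_mult_scalar:
  assumes "\<sigma> \<noteq> 0" "b \<bullet> V \<noteq> 0"
  shows "eig_mult A \<kappa> = CARD('n) - 1"
proof -
  have "{w. A *v w = \<kappa> *\<^sub>R w} = {w. b \<bullet> w = 0}"
    using assms by (auto simp: mult)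
  moreover have "b \<noteq> 0" using assms by auto
  ultimately show ?thesis by (simp add: eig_mult_def dim_hyperplane)
qed

lemma mult_direction: "A *v V = (\<kappa> + \<sigma> * (b \<bullet> V)) *\<^sub>R V"
  by (simp add: mult scaleR_add_left)

text \<open>An eigenvector for this eigenvalue has \<open>\<sigma> (b \<bullet> V) w = \<sigma> (b \<bullet> w) V\<close>, hence is a multiple of
  \<open>V\<close>.\<close>

lemma eig_mult_direction:
  assumes "\<sigma> \<noteq> 0" "b \<bullet> V \<noteq> 0"
  shows "eig_mult A (\<kappa> + \<sigma> * (b \<bullet> V)) = 1"
proof -
  have "{w. A *v w = (\<kappa> + \<sigma> * (b \<bullet> V)) *\<^sub>R w} = span {V}"
  proof (intro equalityI subsetI)
    fix w assume "w \<in> {w. A *v w = (\<kappa> + \<sigma> * (b \<bullet> V)) *\<^sub>R w}"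
    then have "\<sigma> *\<^sub>R ((b \<bullet> V) *\<^sub>R w) = \<sigma> *\<^sub>R ((b \<bullet> w) *\<^sub>R V)"
      by (simp add: mult scaleR_add_left)
    then have "(b \<bullet> V) *\<^sub>R w = (b \<bullet> w) *\<^sub>R V" using assms(1) by (metis scaleR_cancel_left)
    then have "w = ((b \<bullet> w) / (b \<bullet> V)) *\<^sub>R V"
      using assms(2) by (metis divide_inverse_commute scaleR_scaleR scaleR_one left_inverse)
    then show "w \<in> span {V}" unfolding span_singleton by blast
  next
    fix w assume "w \<in> span {V}"
    then obtain c where "w = c *\<^sub>R V" unfolding span_singleton by blast
    then show "w \<in> {w. A *v w = (\<kappa> + \<sigma> * (b \<bullet> V)) *\<^sub>R w}"
      using mult_direction by (simp add: matrix_vector_mult_scaleR mult.commute)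
  qed
  moreover have "independent {V}" using assms(2) by auto
  ultimately show ?thesis
    using dim_span_eq_card_independent[of "{V}"] by (simp add: eig_mult_def)
qed

lemma eig_mult_umbilical:
  assumes "V = 0" "eigenvalue A k"
  shows "eig_mult A k = CARD('n)"
proof -
  obtain w :: "real^'n" where "w \<noteq> 0" "\<kappa> *\<^sub>R w = k *\<^sub>R w"
    using assms by (auto simp: eigenvalue_def mult)
  then have "k = \<kappa>" by simp
  then show ?thesis using assms(1) by (simp add: eig_mult_def mult dim_UNIV)
qed

end

lemma eig_mult_pos:
  assumes "eigenvalue A k" shows "0 < eig_mult A k"
proof -
  obtain w where w: "w \<noteq> 0" "A *v w = k *\<^sub>R w" using assms by (auto simp: eigenvalue_def)
  then have "\<not> {w. A *v w = k *\<^sub>R w} \<subseteq> {0}" by blast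
  then show ?thesis by (metis dim_eq_0 eig_mult_def gr0I)
qed

lemma eigenvalue_exists_dim_1:
  fixes A :: "real^'n::finite^'n"
  assumes "CARD('n) = 1"
  shows "\<exists>k. eigenvalue A k"
proof -
  obtain i :: 'n where i: "UNIV = {i}" using assms by (rule card_1_singletonE)
  have "A *v axis i 1 = (A $ i $ i) *\<^sub>R axis i 1"
  proof (rule vec_eq_iff[THEN iffD2], rule allI)
    fix j
    have "j = i" using i by (metis UNIV_I singletonD)
    then show "(A *v axis i 1) $ j = ((A $ i $ i) *\<^sub>R axis i 1) $ j"
      by (simp add: matrix_vector_mult_def i)
  qed
  then show ?thesis unfolding eigenvalue_def by (metis axis_eq_0_iff zero_neq_one)
qed

section \<open>Immersions of coordinate domains\<close>

lemma matrix_mult_matrix_inv: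
  fixes A :: "real^'n^'n"
  assumes "invertible A"
  shows "A ** matrix_inv A = mat 1"
  using someI_ex[OF assms[unfolded invertible_def]] by (simp add: matrix_inv_def)

lemma frechet_derivative_pd_sum:
  fixes h :: "real^'n::finite \<Rightarrow> 'd::real_normed_vector"
  assumes "h differentiable (at u)"
  shows "frechet_derivative h (at u) a = (\<Sum>i\<in>UNIV. a $ i *\<^sub>R pd i h u)"
proof -
  have lin: "linear (frechet_derivative h (at u))"
    using assms by (rule linear_frechet_derivative)
  have "frechet_derivative h (at u) (\<Sum>i\<in>UNIV. a $ i *\<^sub>R axis i 1) = (\<Sum>i\<in>UNIV. a $ i *\<^sub>R pd i h u)"
    by (simp add: linear_sum[OF lin] linear_cmul[OF lin] pd_def)
  then show ?thesis by (simp add: basis_expansion scalar_mult_eq_scaleR[symmetric])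
qed

lemma pd_inner:
  fixes g h :: "real^'n::finite \<Rightarrow> 'd::real_inner"
  assumes "g differentiable (at u)" "h differentiable (at u)"
  shows "pd i (\<lambda>w. g w \<bullet> h w) u = g u \<bullet> pd i h u + pd i g u \<bullet> h u"
proof -
  have "((\<lambda>w. g w \<bullet> h w) has_derivative
      (\<lambda>v. g u \<bullet> frechet_derivative h (at u) v + frechet_derivative g (at u) v \<bullet> h u)) (at u)"
    by (intro has_derivative_inner has_derivative_frechet assms)
  from fun_cong[OF frechet_derivative_at[OF this], of "axis i 1"] show ?thesis
    by (simp add: pd_def)
qed

text \<open>The coordinate expression \<open>f = x \<circ> \<psi>\<close> of an immersion; the codimension is arbitrary.\<close>

locale immersed_patch =
  fixes f :: "real^'n::finite \<Rightarrow> 'c::euclidean_space" and D :: "(real^'n) set"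
  assumes open_D: "open D"
    and smooth_f: "smooth_on D f"
    and inj_df: "u \<in> D \<Longrightarrow> inj (frechet_derivative f (at u))"
begin

abbreviation df :: "real^'n \<Rightarrow> real^'n \<Rightarrow> 'c" where
  "df u \<equiv> frechet_derivative f (at u)"

text \<open>The second derivative of \<open>f\<close>, spelled out in coordinates so that it is jointly continuous in
  the point and both directions by inspection. Its normal part is the second fundamental form.\<close>

definition second :: "real^'n \<Rightarrow> real^'n \<Rightarrow> real^'n \<Rightarrow> 'c" where
  "second u a b = (\<Sum>i\<in>UNIV. \<Sum>j\<in>UNIV. (a $ i * b $ j) *\<^sub>R pd i (pd j f) u)"

definition gram :: "real^'n \<Rightarrow> real^'n^'n" where
  "gram u = (\<chi> i j. pd i f u \<bullet> pd j f u)"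

lemma differentiable_f: "u \<in> D \<Longrightarrow> f differentiable (at u)"
  using smooth_f by (rule smooth_on_differentiable)

lemma differentiable_pd: "u \<in> D \<Longrightarrow> pd i f differentiable (at u)"
  using smooth_f by (blast intro: smooth_on_differentiable smooth_on_pd)

lemma linear_df: "u \<in> D \<Longrightarrow> linear (df u)"
  by (intro linear_frechet_derivative differentiable_f)

lemma df_sum: "u \<in> D \<Longrightarrow> df u a = (\<Sum>i\<in>UNIV. a $ i *\<^sub>R pd i f u)"
  by (intro frechet_derivative_pd_sum differentiable_f)

lemma df_eq_0_iff: "u \<in> D \<Longrightarrow> df u a = 0 \<longleftrightarrow> a = 0"
  using linear_injective_0[OF linear_df] inj_df[of u] linear_0[OF linear_df] by blast

lemma pd_commute: "u \<in> D \<Longrightarrow> pd i (pd j f) u = pd j (pd i f) u"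
  using symmetric_second_derivative[OF open_D _ smooth_f] by (simp add: pd_def[abs_def])

lemma second_commute: "u \<in> D \<Longrightarrow> second u a b = second u b a"
  unfolding second_def by (subst sum.swap) (simp only: pd_commute mult.commute)

lemma second_axis:
  "second u (axis i 1) w = (\<Sum>j\<in>UNIV. w $ j *\<^sub>R pd i (pd j f) u)"
proof -
  have "second u (axis i 1) w =
      (\<Sum>k\<in>UNIV. if k = i then (\<Sum>j\<in>UNIV. w $ j *\<^sub>R pd k (pd j f) u) else 0)"
    unfolding second_def by (intro sum.cong refl) (auto simp: axis_def)
  then show ?thesis by simp
qed

lemma linear_second_left: "linear (\<lambda>a. second u a b)"
  by (rule linearI) (simp_all add: second_def distrib_right scaleR_left_distrib sum.distrib
      scaleR_sum_right mult.assoc)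

lemma linear_second_right: "linear (second u a)"
  by (rule linearI) (simp_all add: second_def distrib_left scaleR_left_distrib sum.distrib
      scaleR_sum_right mult.left_commute)

lemma has_derivative_df:
  assumes "u \<in> D"
  shows "((\<lambda>w. df w b) has_derivative (\<lambda>a. second u a b)) (at u)"
proof -
  have "((\<lambda>w. \<Sum>j\<in>UNIV. b $ j *\<^sub>R pd j f w) has_derivative
      (\<lambda>a. \<Sum>j\<in>UNIV. b $ j *\<^sub>R frechet_derivative (pd j f) (at u) a)) (at u)"
    by (intro has_derivative_sum has_derivative_scaleR_right has_derivative_frechet
        differentiable_pd assms)
  moreover have "(\<Sum>j\<in>UNIV. b $ j *\<^sub>R frechet_derivative (pd j f) (at u) a) = second u a b" for a
    unfolding second_def frechet_derivative_pd_sum[OF differentiable_pd[OF assms]]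
    by (subst sum.swap) (simp add: scaleR_sum_right mult.commute)
  ultimately have "((\<lambda>w. \<Sum>j\<in>UNIV. b $ j *\<^sub>R pd j f w) has_derivative (\<lambda>a. second u a b)) (at u)"
    by simp
  then show ?thesis
    by (rule has_derivative_transform_within_open[OF _ open_D assms]) (simp add: df_sum)
qed

lemma tendsto_second:
  assumes "u \<in> D" "(w \<longlongrightarrow> u) F" "(a \<longlongrightarrow> a') F" "(b \<longlongrightarrow> b') F"
  shows "((\<lambda>k. second (w k) (a k) (b k)) \<longlongrightarrow> second u a' b') F"
  unfolding second_def
proof (intro tendsto_sum tendsto_scaleR tendsto_mult tendsto_vec_nth assms)
  fix i j
  have "isCont (pd i (pd j f)) u"
    using smooth_on_continuous[OF smooth_on_pd[OF smooth_on_pd[OF smooth_f]]] open_D assms(1)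
    by (simp add: continuous_on_eq_continuous_at)
  then show "((\<lambda>k. pd i (pd j f) (w k)) \<longlongrightarrow> pd i (pd j f) u) F"
    using assms(2) by (rule isCont_tendsto_compose)
qed

lemma tendsto_df:
  assumes "u \<in> D" "(w \<longlongrightarrow> u) F" "(a \<longlongrightarrow> a') F" "eventually (\<lambda>k. w k \<in> D) F"
  shows "((\<lambda>k. df (w k) (a k)) \<longlongrightarrow> df u a') F"
proof -
  have "((\<lambda>k. \<Sum>i\<in>UNIV. a k $ i *\<^sub>R pd i f (w k)) \<longlongrightarrow> (\<Sum>i\<in>UNIV. a' $ i *\<^sub>R pd i f u)) F"
  proof (intro tendsto_sum tendsto_scaleR tendsto_vec_nth assms)
    fix i
    have "isCont (pd i f) u"
      using smooth_on_continuous[OF smooth_on_pd[OF smooth_f]] open_D assms(1)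
      by (simp add: continuous_on_eq_continuous_at)
    then show "((\<lambda>k. pd i f (w k)) \<longlongrightarrow> pd i f u) F"
      using assms(2) by (rule isCont_tendsto_compose)
  qed
  then show ?thesis
    unfolding df_sum[OF assms(1)]
    by (rule Lim_transform_eventually) (use assms(4) in eventually_elim, simp add: df_sum)
qed

lemma gram_mult: "u \<in> D \<Longrightarrow> (gram u *v a) $ i = pd i f u \<bullet> df u a"
  by (simp add: gram_def matrix_vector_mult_def df_sum inner_sum_right mult.commute)

lemma df_pd: "pd i f u = df u (axis i 1)"
  by (simp add: pd_def)

lemma inner_gram:
  assumes "u \<in> D" shows "a \<bullet> (gram u *v b) = df u a \<bullet> df u b"
  unfolding df_sum[OF assms, of a] by (simp add: inner_vec_def gram_mult assms inner_sum_left)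

lemma invertible_gram:
  assumes "u \<in> D" shows "invertible (gram u)"
proof -
  have "a = 0" if "gram u *v a = 0" for a
    using inner_gram[OF assms, of a a] that by (simp add: df_eq_0_iff[OF assms])
  then show ?thesis
    by (simp add: invertible_left_inverse matrix_left_invertible_ker)
qed

lemma gram_cancel: "u \<in> D \<Longrightarrow> gram u *v a = gram u *v b \<Longrightarrow> a = b"
  using invertible_gram[of u] by (metis inj_eq inj_matrix_vector_mult)

lemma gram_inverse_mult: "u \<in> D \<Longrightarrow> gram u *v (matrix_inv (gram u) *v a) = a"
  using invertible_gram[of u] by (simp add: matrix_vector_mul_assoc matrix_mult_matrix_inv)

text \<open>In codimension one the orthogonal complement of the tangent space is a line.\<close>

lemma normal_line:
  assumes codim: "DIM('c) = CARD('n) + 1" and u: "u \<in> D"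
    and \<nu>: "norm \<nu> = 1" "\<And>a. \<nu> \<bullet> df u a = 0" and y: "\<And>a. y \<bullet> df u a = 0"
  shows "y = (y \<bullet> \<nu>) *\<^sub>R \<nu>"
proof -
  let ?R = "range (df u)"
  let ?P = "{y \<in> UNIV. \<forall>v\<in>?R. orthogonal v y}"
  have sub: "subspace ?R" using linear_subspace_image[OF linear_df[OF u] subspace_UNIV] .
  have "dim ?R = CARD('n)"
    using dim_image_eq[OF linear_df[OF u], of UNIV] inj_df[OF u] by (simp add: dim_UNIV)
  then have P: "dim ?P = 1"
    using dim_subspace_orthogonal_to_vectors[OF sub subspace_UNIV] codim by simp
  have "subspace ?P" by (auto simp: subspace_def orthogonal_def inner_add_right)
  moreover have "span {\<nu>} \<subseteq> ?P"
    using \<nu>(2) \<open>subspace ?P\<close> by (intro span_minimal) (auto simp: orthogonal_def inner_commute)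
  moreover have "dim (span {\<nu>}) = 1"
  proof -
    have "\<nu> \<noteq> 0" using \<nu>(1) by auto
    then have "independent {\<nu>}" by simp
    then show ?thesis using dim_span_eq_card_independent by fastforce
  qed
  ultimately have "span {\<nu>} = ?P"
    using P by (intro subspace_dim_equal) auto
  moreover have "y \<in> ?P" using y by (auto simp: orthogonal_def inner_commute)
  ultimately have "y \<in> span {\<nu>}" by simp
  then obtain c where "y = c *\<^sub>R \<nu>" unfolding span_singleton by blast
  then show ?thesis using \<nu>(1) by (simp add: norm_eq_1)
qed

lemma pd_gram:
  "u \<in> D \<Longrightarrow> pd k (\<lambda>w. gram w $ i $ j) u = pd k (pd i f) u \<bullet> pd j f u + pd k (pd j f) u \<bullet> pd i f u"
  by (simp add: gram_def pd_inner differentiable_pd inner_commute)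

text \<open>The Christoffel symbols of the induced metric are the coefficients of the tangential parts of
  the second partial derivatives.\<close>

lemma gram_christoffel:
  assumes "u \<in> D"
  shows "(\<Sum>k\<in>UNIV. gram u $ m $ k * christoffel gram u k i j) = pd i (pd j f) u \<bullet> pd m f u"
proof -
  have "christoffel gram u k i j = (matrix_inv (gram u) *v (\<chi> l. pd i (pd j f) u \<bullet> pd l f u)) $ k" for k
  proof -
    have "pd i (\<lambda>w. gram w $ j $ l) u + pd j (\<lambda>w. gram w $ i $ l) u - pd l (\<lambda>w. gram w $ i $ j) u =
        2 * (pd i (pd j f) u \<bullet> pd l f u)" for l
      by (simp add: pd_gram assms pd_commute[OF assms, of j i] pd_commute[OF assms, of i l]
          pd_commute[OF assms, of j l])
    then show ?thesis
      by (simp add: christoffel_def matrix_vector_mult_def sum_distrib_left)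
  qed
  then have "(\<Sum>k\<in>UNIV. gram u $ m $ k * christoffel gram u k i j) =
      (gram u *v (matrix_inv (gram u) *v (\<chi> l. pd i (pd j f) u \<bullet> pd l f u))) $ m"
    by (simp add: matrix_vector_mult_def[of "gram u"])
  then show ?thesis by (simp add: gram_inverse_mult assms)
qed

end

section \<open>The tangential part of the position vector\<close>

text \<open>\<open>V\<close> is the coordinate expression of the tangential part of the position vector \<open>f\<close>.\<close>

locale position_patch = immersed_patch f D
  for f :: "real^'n::finite \<Rightarrow> 'c::euclidean_space" and D +
  fixes V :: "real^'n \<Rightarrow> real^'n"
  assumes smooth_V: "smooth_on D V"
    and orthogonal_rest: "u \<in> D \<Longrightarrow> (f u - df u (V u)) \<bullet> df u a = 0"
begin

definition T :: "real^'n \<Rightarrow> 'c" where "T u = df u (V u)"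
definition N :: "real^'n \<Rightarrow> 'c" where "N u = f u - T u"

lemma f_split: "f u = T u + N u"
  by (simp add: N_def)

lemma N_df: "u \<in> D \<Longrightarrow> N u \<bullet> df u a = 0"
  using orthogonal_rest by (simp add: N_def T_def)

lemma N_T: "u \<in> D \<Longrightarrow> N u \<bullet> T u = 0"
  by (simp add: N_df T_def)

lemma gram_V: "u \<in> D \<Longrightarrow> (gram u *v V u) $ i = pd i f u \<bullet> T u"
  by (simp add: gram_mult T_def)

lemma T_eq_0_iff: "u \<in> D \<Longrightarrow> T u = 0 \<longleftrightarrow> V u = 0"
  by (simp add: T_def df_eq_0_iff)

lemma differentiable_V: "u \<in> D \<Longrightarrow> V differentiable (at u)"
  using smooth_V by (rule smooth_on_differentiable)

lemma differentiable_V_nth: "u \<in> D \<Longrightarrow> (\<lambda>w. V w $ k) differentiable (at u)"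
  using bounded_linear.has_derivative[OF bounded_linear_vec_nth has_derivative_frechet[OF differentiable_V]]
  by (auto simp: differentiable_def)

lemma has_derivative_T:
  assumes "u \<in> D"
  shows "(T has_derivative (\<lambda>a. \<Sum>k\<in>UNIV. V u $ k *\<^sub>R frechet_derivative (pd k f) (at u) a +
    frechet_derivative (\<lambda>w. V w $ k) (at u) a *\<^sub>R pd k f u)) (at u)"
proof -
  have "((\<lambda>w. \<Sum>k\<in>UNIV. V w $ k *\<^sub>R pd k f w) has_derivative
    (\<lambda>a. \<Sum>k\<in>UNIV. V u $ k *\<^sub>R frechet_derivative (pd k f) (at u) a +
    frechet_derivative (\<lambda>w. V w $ k) (at u) a *\<^sub>R pd k f u)) (at u)"
    by (intro has_derivative_sum has_derivative_scaleR has_derivative_frechet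
        differentiable_pd differentiable_V_nth assms)
  then show ?thesis
    by (rule has_derivative_transform_within_open[OF _ open_D assms]) (simp add: T_def df_sum)
qed

lemma differentiable_T: "u \<in> D \<Longrightarrow> T differentiable (at u)"
  using has_derivative_T by (auto simp: differentiable_def)

lemma pd_T:
  "u \<in> D \<Longrightarrow> pd i T u = (\<Sum>k\<in>UNIV. V u $ k *\<^sub>R pd i (pd k f) u + pd i (\<lambda>w. V w $ k) u *\<^sub>R pd k f u)"
  using fun_cong[OF frechet_derivative_at[OF has_derivative_T], of u "axis i 1"]
  by (simp add: pd_def)

text \<open>This is where the flat connection of the ambient space enters: the position vector has the
  identity as its derivative, so differentiating the constant \<open>N \<bullet> \<partial>\<^sub>j f = 0\<close> leaves the metric and
  the second fundamental form in the direction \<open>N\<close>.\<close>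

lemma pd_T_inner:
  assumes "u \<in> D"
  shows "pd i T u \<bullet> pd j f u = gram u $ i $ j + N u \<bullet> pd i (pd j f) u"
proof -
  have dN: "N differentiable (at u)" and pN: "pd i N u = pd i f u - pd i T u"
  proof -
    have d: "(N has_derivative (\<lambda>a. df u a - frechet_derivative T (at u) a)) (at u)"
      unfolding N_def[abs_def]
      by (intro has_derivative_diff has_derivative_frechet differentiable_f differentiable_T assms)
    then show "N differentiable (at u)" by (auto simp: differentiable_def)
    show "pd i N u = pd i f u - pd i T u"
      using fun_cong[OF frechet_derivative_at[OF d], of "axis i 1"] by (simp add: pd_def)
  qed
  have "((\<lambda>w. N w \<bullet> pd j f w) has_derivative (\<lambda>a. 0)) (at u)"
    by (rule has_derivative_transform_within_open[OF has_derivative_const open_D assms])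
      (simp add: df_pd N_df)
  then have "pd i (\<lambda>w. N w \<bullet> pd j f w) u = 0"
    using fun_cong[OF frechet_derivative_at, of "\<lambda>w. N w \<bullet> pd j f w" "\<lambda>a. 0" u "axis i 1"]
    by (simp add: pd_def)
  then have "N u \<bullet> pd i (pd j f) u + (pd i f u - pd i T u) \<bullet> pd j f u = 0"
    using pd_inner[OF dN differentiable_pd[OF assms], of i j] pN by simp
  then show ?thesis by (simp add: gram_def inner_diff_left)
qed

text \<open>The Lie derivative is twice the symmetrization of \<open>\<langle>\<partial>\<^sub>i T, \<partial>\<^sub>j f\<rangle>\<close>, by the product rule and the
  symmetry of second derivatives; and this bilinear form is already symmetric.\<close>

lemma lie_derivative_gram:
  assumes "u \<in> D"
  shows "lie_deriv_metric V gram u $ i $ j = 2 * (gram u $ i $ j + N u \<bullet> pd i (pd j f) u)"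
proof -
  have "lie_deriv_metric V gram u $ i $ j = pd i T u \<bullet> pd j f u + pd j T u \<bullet> pd i f u"
  proof -
    have "V u $ k * pd k (\<lambda>w. gram w $ i $ j) u + gram u $ k $ j * pd i (\<lambda>w. V w $ k) u
        + gram u $ i $ k * pd j (\<lambda>w. V w $ k) u =
      (V u $ k *\<^sub>R pd i (pd k f) u + pd i (\<lambda>w. V w $ k) u *\<^sub>R pd k f u) \<bullet> pd j f u +
      (V u $ k *\<^sub>R pd j (pd k f) u + pd j (\<lambda>w. V w $ k) u *\<^sub>R pd k f u) \<bullet> pd i f u" for k
      by (simp add: pd_gram assms pd_commute[OF assms, of i k] pd_commute[OF assms, of j k]
          inner_add_left distrib_left) (simp add: gram_def inner_commute)
    then show ?thesis
      unfolding pd_T[OF assms] inner_sum_left sum.distrib[symmetric]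
      by (simp add: lie_deriv_metric_def)
  qed
  also have "\<dots> = 2 * (gram u $ i $ j + N u \<bullet> pd i (pd j f) u)"
    by (simp add: pd_T_inner assms pd_commute[OF assms, of j i]) (simp add: gram_def inner_commute)
  finally show ?thesis .
qed

text \<open>The covariant derivative is the tangential part of the ambient derivative of \<open>T\<close>.\<close>

lemma gram_cov_deriv:
  assumes "u \<in> D"
  shows "(gram u *v cov_deriv gram V u a) $ m =
    (\<Sum>i\<in>UNIV. a $ i * (gram u $ i $ m + N u \<bullet> pd i (pd m f) u))"
proof -
  define C where
    "C k i = pd i (\<lambda>w. V w $ k) u + (\<Sum>j\<in>UNIV. christoffel gram u k i j * V u $ j)" for k i
  have C: "(\<Sum>k\<in>UNIV. gram u $ m $ k * C k i) = pd i T u \<bullet> pd m f u" for i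
  proof -
    have "(\<Sum>k\<in>UNIV. gram u $ m $ k * C k i) = (\<Sum>k\<in>UNIV. gram u $ m $ k * pd i (\<lambda>w. V w $ k) u) +
        (\<Sum>k\<in>UNIV. \<Sum>j\<in>UNIV. gram u $ m $ k * christoffel gram u k i j * V u $ j)"
      by (simp add: C_def distrib_left sum.distrib sum_distrib_left mult.assoc)
    also have "(\<Sum>k\<in>UNIV. \<Sum>j\<in>UNIV. gram u $ m $ k * christoffel gram u k i j * V u $ j) =
        (\<Sum>j\<in>UNIV. (\<Sum>k\<in>UNIV. gram u $ m $ k * christoffel gram u k i j) * V u $ j)"
      by (subst sum.swap) (simp add: sum_distrib_right)
    also have "(\<Sum>k\<in>UNIV. gram u $ m $ k * pd i (\<lambda>w. V w $ k) u) + \<dots> = pd i T u \<bullet> pd m f u"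
      unfolding gram_christoffel[OF assms] pd_T[OF assms] inner_sum_left inner_add_left sum.distrib
      by (simp add: gram_def inner_commute mult.commute)
    finally show ?thesis .
  qed
  have "(gram u *v cov_deriv gram V u a) $ m = (\<Sum>k\<in>UNIV. \<Sum>i\<in>UNIV. gram u $ m $ k * (a $ i * C k i))"
    by (simp add: cov_deriv_def matrix_vector_mult_def C_def sum_distrib_left)
  also have "\<dots> = (\<Sum>i\<in>UNIV. a $ i * (\<Sum>k\<in>UNIV. gram u $ m $ k * C k i))"
    by (subst sum.swap) (simp add: sum_distrib_left algebra_simps)
  also have "\<dots> = (\<Sum>i\<in>UNIV. a $ i * (pd i T u \<bullet> pd m f u))" by (simp only: C)
  finally show ?thesis by (simp add: pd_T_inner assms)
qed

end

section \<open>The soliton equation in a parametrization\<close>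

text \<open>Here \<open>\<phi>\<close> is \<open>R - \<lambda>\<close> and \<open>m\<close> is \<open>\<mu>\<close>.\<close>

locale soliton_patch = position_patch f D V
  for f :: "real^'n::finite \<Rightarrow> 'c::euclidean_space" and D V +
  fixes \<phi> m :: "real^'n \<Rightarrow> real"
  assumes soliton: "u \<in> D \<Longrightarrow> (1/2) * lie_deriv_metric V gram u $ i $ j =
      \<phi> u * gram u $ i $ j + m u * ((gram u *v V u) $ i * (gram u *v V u) $ j)"
    and smooth_m: "smooth_on D m"
    and m_nonzero: "u \<in> D \<Longrightarrow> m u \<noteq> 0"
begin

lemma N_inner_pd:
  "u \<in> D \<Longrightarrow> N u \<bullet> pd i (pd j f) u =
    (\<phi> u - 1) * (pd i f u \<bullet> pd j f u) + m u * ((T u \<bullet> pd i f u) * (T u \<bullet> pd j f u))"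
  using soliton[of u i j]
  by (simp add: lie_derivative_gram gram_V inner_commute algebra_simps) (simp add: gram_def algebra_simps)

lemma N_inner_second:
  assumes "u \<in> D"
  shows "N u \<bullet> second u a b =
    (\<phi> u - 1) * (df u a \<bullet> df u b) + m u * ((T u \<bullet> df u a) * (T u \<bullet> df u b))"
proof -
  have "N u \<bullet> second u a b = (\<Sum>i\<in>UNIV. \<Sum>j\<in>UNIV. a $ i * b $ j *
    ((\<phi> u - 1) * (pd i f u \<bullet> pd j f u) + m u * ((T u \<bullet> pd i f u) * (T u \<bullet> pd j f u))))"
    by (simp add: second_def inner_sum_right N_inner_pd assms)
  also have "\<dots> = (\<phi> u - 1) * (\<Sum>i\<in>UNIV. \<Sum>j\<in>UNIV. a $ i * b $ j * (pd i f u \<bullet> pd j f u)) +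
     m u * (\<Sum>i\<in>UNIV. \<Sum>j\<in>UNIV. (a $ i * (T u \<bullet> pd i f u)) * (b $ j * (T u \<bullet> pd j f u)))"
    unfolding sum_distrib_left sum.distrib[symmetric]
    by (intro sum.cong refl) (simp add: algebra_simps)
  also have "(\<Sum>i\<in>UNIV. \<Sum>j\<in>UNIV. (a $ i * (T u \<bullet> pd i f u)) * (b $ j * (T u \<bullet> pd j f u))) =
     (\<Sum>i\<in>UNIV. a $ i * (T u \<bullet> pd i f u)) * (\<Sum>j\<in>UNIV. b $ j * (T u \<bullet> pd j f u))"
    by (rule sum_product[symmetric])
  also have "(\<Sum>i\<in>UNIV. \<Sum>j\<in>UNIV. a $ i * b $ j * (pd i f u \<bullet> pd j f u)) = df u a \<bullet> df u b"
    by (subst sum.swap, simp add: df_sum assms inner_sum_left inner_sum_right mult.assoc)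
      (simp add: sum_distrib_left mult.left_commute)
  also have "(\<Sum>i\<in>UNIV. a $ i * (T u \<bullet> pd i f u)) = T u \<bullet> df u a"
    by (simp add: df_sum assms inner_sum_right)
  also have "(\<Sum>j\<in>UNIV. b $ j * (T u \<bullet> pd j f u)) = T u \<bullet> df u b"
    by (simp add: df_sum assms inner_sum_right)
  finally show ?thesis .
qed

lemma cov_deriv_V:
  assumes "u \<in> D"
  shows "cov_deriv gram V u a = \<phi> u *\<^sub>R a + (m u * (T u \<bullet> df u a)) *\<^sub>R V u"
proof (rule gram_cancel[OF assms], rule vec_eq_iff[THEN iffD2], rule allI)
  fix k
  have "(gram u *v cov_deriv gram V u a) $ k = (\<Sum>i\<in>UNIV. a $ i *
      (\<phi> u * (pd i f u \<bullet> pd k f u) + m u * ((T u \<bullet> pd i f u) * (T u \<bullet> pd k f u))))"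
    unfolding gram_cov_deriv[OF assms] N_inner_pd[OF assms]
    by (simp add: gram_def algebra_simps)
  also have "\<dots> = \<phi> u * (\<Sum>i\<in>UNIV. a $ i * (pd i f u \<bullet> pd k f u)) +
      m u * (\<Sum>i\<in>UNIV. a $ i * (T u \<bullet> pd i f u)) * (T u \<bullet> pd k f u)"
    by (simp add: sum.distrib sum_distrib_left sum_distrib_right algebra_simps)
  also have "\<dots> = \<phi> u * (df u a \<bullet> pd k f u) + m u * (T u \<bullet> df u a) * (T u \<bullet> pd k f u)"
    by (simp add: df_sum assms inner_sum_left inner_sum_right)
  also have "\<dots> = (gram u *v (\<phi> u *\<^sub>R a + (m u * (T u \<bullet> df u a)) *\<^sub>R V u)) $ k"
    by (simp add: matrix_vector_right_distrib matrix_vector_mult_scaleR gram_mult T_def assms inner_commute)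
  finally show "(gram u *v cov_deriv gram V u a) $ k =
      (gram u *v (\<phi> u *\<^sub>R a + (m u * (T u \<bullet> df u a)) *\<^sub>R V u)) $ k" .
qed

lemma smooth_gram: "smooth_on D (\<lambda>u. gram u $ i $ j)"
proof -
  have "smooth_on D (\<lambda>u. \<Sum>b\<in>Basis. (pd i f u \<bullet> b) * (pd j f u \<bullet> b))"
    by (intro smooth_on_sum smooth_on_mult open_D finite_Basis
        smooth_on_linear[OF open_D bounded_linear_inner_left smooth_on_pd[OF smooth_f]])
  then show ?thesis by (simp add: gram_def euclidean_inner[symmetric])
qed

lemma smooth_V_nth: "smooth_on D (\<lambda>u. V u $ i)"
  by (rule smooth_on_linear[OF open_D bounded_linear_vec_nth smooth_V])

lemma smooth_gram_V: "smooth_on D (\<lambda>u. (gram u *v V u) $ i)"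
  unfolding matrix_vector_mult_def
  by (simp, intro smooth_on_sum smooth_on_mult open_D finite smooth_gram smooth_V_nth)

text \<open>A diagonal component of the soliton equation expresses \<open>\<phi>\<close> as a quotient of smooth functions.\<close>

lemma smooth_\<phi>: "smooth_on D \<phi>"
proof -
  fix i :: 'n
  let ?L = "\<lambda>u. lie_deriv_metric V gram u $ i $ i" and ?b = "\<lambda>u. (gram u *v V u) $ i"
  have L: "smooth_on D ?L"
    unfolding lie_deriv_metric_def
    by (simp, intro smooth_on_sum smooth_on_add smooth_on_mult open_D finite smooth_on_pd
        smooth_gram smooth_V_nth)
  have pos: "gram u $ i $ i \<noteq> 0" if "u \<in> D" for u
    using df_eq_0_iff[OF that, of "axis i 1"] by (simp add: gram_def df_pd axis_eq_0_iff)
  have "smooth_on D (\<lambda>u. ((1/2) * ?L u - m u * (?b u * ?b u)) / gram u $ i $ i)"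
    by (intro smooth_on_divide smooth_on_diff smooth_on_mult smooth_on_const open_D smooth_gram
        smooth_gram_V smooth_m L pos)
  then show ?thesis
    by (rule smooth_on_cong[OF open_D, rotated]) (use soliton pos in \<open>simp add: field_simps\<close>)
qed

text \<open>A vector \<open>w \<noteq> 0\<close> with \<open>\<langle>T, w\<rangle> = 0\<close> isolates the coefficient \<open>\<phi> - 1\<close>; after that, \<open>T\<close> itself
  isolates \<open>m \<bar>T\<bar>\<^sup>4\<close>.\<close>

lemma N_nonzero_if_f_nonzero:
  assumes "2 \<le> CARD('n)" "u \<in> D" "f u \<noteq> 0"
  shows "N u \<noteq> 0"
proof
  assume N: "N u = 0"
  obtain w where w: "w \<noteq> 0" "(gram u *v V u) \<bullet> w = 0"
    using exists_orthogonal_nonzero[OF assms(1)] by blast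
  have Tw: "T u \<bullet> df u w = 0"
    using w(2) inner_gram[OF assms(2), of w "V u"] by (simp add: T_def inner_commute)
  have "\<phi> u = 1"
    using N_inner_second[OF assms(2), of w w] N Tw w(1) df_eq_0_iff[OF assms(2)] by simp
  then have "m u * (T u \<bullet> T u)^2 = 0"
    using N_inner_second[OF assms(2), of "V u" "V u"] N by (simp add: T_def power2_eq_square)
  then have "T u = 0" using m_nonzero[OF assms(2)] by simp
  then show False using N assms(3) by (simp add: N_def)
qed

section \<open>Zeros of the position vector\<close>

text \<open>\<open>\<bar>N\<bar>\<close> is the distance of \<open>f\<close> from the tangent space, and the tangent vector \<open>t df(d)\<close>
  approximates \<open>f(u + t d)\<close> to second order.\<close>

lemma norm_N_quadratic:
  assumes u: "u \<in> D" "f u = 0"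
  obtains C e where "0 < C" "0 < e"
    "\<And>t. 0 < t \<Longrightarrow> t < e \<Longrightarrow> u + t *\<^sub>R d \<in> D \<and> norm (N (u + t *\<^sub>R d)) \<le> C * t^2"
proof -
  let ?w = "\<lambda>s. u + s *\<^sub>R d"
  have w: "(?w \<longlongrightarrow> u) (at 0)"
    by (rule tendsto_eq_intros refl | simp)+
  define C where "C = norm (second u d d) + 1"
  have "((\<lambda>s. norm (second (?w s) d d)) \<longlongrightarrow> norm (second u d d)) (at 0)"
    by (intro tendsto_norm tendsto_second u w tendsto_const)
  then have "eventually (\<lambda>s. norm (second (?w s) d d) < C) (at 0)"
    by (rule order_tendstoD) (simp add: C_def)
  moreover have "eventually (\<lambda>s. ?w s \<in> D) (at 0)"
    using topological_tendstoD[OF w open_D u(1)] .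
  ultimately have "eventually (\<lambda>s. norm (second (?w s) d d) < C \<and> ?w s \<in> D) (at 0)"
    by eventually_elim simp
  then obtain e where e: "e > 0"
    "\<And>s. s \<noteq> 0 \<Longrightarrow> \<bar>s\<bar> < e \<Longrightarrow> norm (second (?w s) d d) < C \<and> ?w s \<in> D"
    unfolding eventually_at by (auto simp: dist_real_def)
  have wD: "?w s \<in> D" if "\<bar>s\<bar> < e" for s
    using e(2)[of s] that u(1) by (cases "s = 0") auto
  have dw: "(?w has_derivative (\<lambda>y. y *\<^sub>R d)) (at s)" for s
    by (auto intro!: derivative_eq_intros)
  define g where "g s = f (?w s) - s *\<^sub>R df (?w s) d" for s
  have dg: "(g has_derivative (\<lambda>y. - (s * y) *\<^sub>R second (?w s) d d)) (at s)" if "\<bar>s\<bar> < e" for s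
  proof -
    have 1: "((\<lambda>s. f (?w s)) has_derivative (\<lambda>y. df (?w s) (y *\<^sub>R d))) (at s)"
      by (rule has_derivative_compose[OF dw has_derivative_frechet[OF differentiable_f[OF wD[OF that]]]])
    have 2: "((\<lambda>s. df (?w s) d) has_derivative (\<lambda>y. second (?w s) (y *\<^sub>R d) d)) (at s)"
      by (rule has_derivative_compose[OF dw has_derivative_df[OF wD[OF that]]])
    have 3: "(g has_derivative (\<lambda>y. df (?w s) (y *\<^sub>R d) -
        (s *\<^sub>R second (?w s) (y *\<^sub>R d) d + y *\<^sub>R df (?w s) d))) (at s)"
      unfolding g_def[abs_def]
      by (intro has_derivative_diff 1 has_derivative_scaleR has_derivative_ident 2)
    show ?thesis
      using 3 by (simp add: linear_cmul[OF linear_df[OF wD[OF that]]] linear_cmul[OF linear_second_left])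
  qed
  show thesis
  proof (rule that[of C e])
    show "0 < C" by (simp add: C_def add_nonneg_pos)
    show "0 < e" by fact
    fix t :: real assume t: "0 < t" "t < e"
    have tD: "?w t \<in> D" using wD[of t] t by simp
    have "\<exists>s\<in>{0<..<t}. norm (g t - g 0) \<le> norm (- (s * (t - 0)) *\<^sub>R second (?w s) d d)"
    proof (rule mvt_general[OF t(1)])
      show "continuous_on {0..t} g"
        using has_derivative_continuous[OF dg] t by (intro continuous_at_imp_continuous_on) auto
      show "(g has_derivative (\<lambda>y. - (s * y) *\<^sub>R second (?w s) d d)) (at s)" if "0 < s" "s < t" for s
        using dg[of s] that t by simp
    qed
    then obtain s where s: "0 < s" "s < t" "norm (g t - g 0) \<le> s * t * norm (second (?w s) d d)"
      using t by (auto simp: abs_mult)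
    have "s * t * norm (second (?w s) d d) \<le> (t * t) * C"
      using s t e(2)[of s] by (intro mult_mono mult_right_mono) (auto intro: less_imp_le)
    then have g: "norm (g t) \<le> C * t^2"
      using s(3) u(2) by (simp add: g_def power2_eq_square mult.commute)
    \<comment> \<open>\<open>N\<close> is the normal part of \<open>f\<close>, so subtracting a tangent vector does not change it.\<close>
    have "N (?w t) \<bullet> g t = N (?w t) \<bullet> N (?w t)"
      unfolding g_def by (simp add: inner_diff_right N_df tD f_split[of "?w t"] inner_add_right N_T)
    then have "(norm (N (?w t)))\<^sup>2 \<le> norm (N (?w t)) * norm (g t)"
      using norm_cauchy_schwarz[of "N (?w t)" "g t"] by (simp add: power2_norm_eq_inner)
    then have "norm (N (?w t)) \<le> norm (g t)"
      by (simp add: power2_eq_square mult_le_cancel_left)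
         (metis norm_ge_zero order_trans norm_eq_zero norm_zero less_eq_real_def)
    then show "?w t \<in> D \<and> norm (N (?w t)) \<le> C * t^2" using g tD by simp
  qed
qed

text \<open>Inserting \<open>V / t\<close> and a vector \<open>z'\<close> orthogonal to it into the equation for \<open>\<langle>N, h\<rangle>\<close> and dividing
  by \<open>\<bar>N\<bar>\<close> gives zero. Comparing instead the normalized values on \<open>V / t\<close> and on \<open>z'\<close> eliminates \<open>\<phi>\<close> and
  leaves \<open>m \<bar>T\<bar>\<^sup>2 / \<bar>N\<bar>\<close>, which is bounded away from zero since \<open>\<bar>T\<bar>\<close> is of order \<open>t\<close> and \<open>\<bar>N\<bar>\<close> at most
  of order \<open>t\<^sup>2\<close>. Both statements survive the limit \<open>t \<rightarrow> 0\<close>, in which \<open>V / t\<close> and \<open>z'\<close> tend to \<open>d\<close>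
  and \<open>z\<close>.\<close>

lemma blow_up_second:
  assumes n: "2 \<le> CARD('n)" and u: "u \<in> D" "f u = 0"
    and d: "d \<noteq> 0" and z: "z \<noteq> 0" and dz: "df u d \<bullet> df u z = 0"
    and t: "t \<longlonglongrightarrow> 0" "\<And>k. 0 < t k"
    and \<nu>: "(\<lambda>k. sgn (N (u + t k *\<^sub>R d))) \<longlonglongrightarrow> \<nu>"
  shows "norm \<nu> = 1" "\<nu> \<bullet> df u a = 0" "\<nu> \<bullet> second u d z = 0"
    "\<nu> \<bullet> second u d d / (df u d \<bullet> df u d) \<noteq> \<nu> \<bullet> second u z z / (df u z \<bullet> df u z)"
proof -
  define w where "w k = u + t k *\<^sub>R d" for k
  have wu: "w \<longlonglongrightarrow> u"
    unfolding w_def using tendsto_add[OF tendsto_const tendsto_scaleR[OF t(1) tendsto_const[of d]], of u]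
    by simp
  have wD: "eventually (\<lambda>k. w k \<in> D) sequentially"
    using topological_tendstoD[OF wu open_D u(1)] .
  have nz: "df u d \<noteq> 0" "df u z \<noteq> 0" using d z df_eq_0_iff[OF u(1)] by auto
  have tn: "t k \<noteq> 0" for k using t(2)[of k] by simp
  note lims = tendsto_df[OF u(1) wu _ wD] tendsto_second[OF u(1) wu]
  define Vt Tt where "Vt k = V (w k) /\<^sub>R t k" and "Tt k = df (w k) (Vt k)" for k
  have T0: "T u = 0"
    using N_T[OF u(1)] u(2) f_split[of u] by (simp add: add_eq_0_iff2)
  have V0: "V u = 0" using T0 T_eq_0_iff[OF u(1)] by simp
  have ft: "(\<lambda>k. f (w k) /\<^sub>R t k) \<longlonglongrightarrow> df u d"
    using tendsto_difference_quotient[OF has_derivative_frechet[OF differentiable_f[OF u(1)]] d t(1) tn]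
    by (simp add: w_def u(2))
  define v0 where "v0 = frechet_derivative V (at u) d"
  have Vt: "Vt \<longlonglongrightarrow> v0"
    using tendsto_difference_quotient[OF has_derivative_frechet[OF differentiable_V[OF u(1)]] d t(1) tn]
    by (simp add: w_def V0 Vt_def[abs_def] v0_def)
  have Tt: "Tt \<longlonglongrightarrow> df u v0"
    unfolding Tt_def[abs_def] by (rule lims(1)[OF Vt])
  have TTt: "T (w k) = t k *\<^sub>R Tt k" if "w k \<in> D" for k
    using linear_cmul[OF linear_df[OF that], of "t k" "Vt k"] tn[of k] by (simp add: Tt_def Vt_def T_def)
  \<comment> \<open>To first order the normal part of \<open>f\<close> vanishes, so \<open>V\<close> grows like the displacement from \<open>u\<close>.\<close>
  have Nt: "(\<lambda>k. (N (w k) /\<^sub>R t k) \<bullet> df (w k) a) \<longlonglongrightarrow> (df u d - df u v0) \<bullet> df u a" for a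
  proof -
    have "(\<lambda>k. (f (w k) /\<^sub>R t k - Tt k) \<bullet> df (w k) a) \<longlonglongrightarrow> (df u d - df u v0) \<bullet> df u a"
      by (intro tendsto_inner tendsto_diff ft Tt lims(1)[OF tendsto_const])
    then show ?thesis
      by (rule Lim_transform_eventually) (use wD in eventually_elim,
        simp add: N_def TTt tn scaleR_right_diff_distrib)
  qed
  have "eventually (\<lambda>k. (N (w k) /\<^sub>R t k) \<bullet> df (w k) a = 0) sequentially" for a
    using wD by eventually_elim (simp add: N_df)
  then have "(df u d - df u v0) \<bullet> df u a = 0" for a
    by (rule limit_of_eventually_const[OF Nt])
  from this[of "d - v0"] have v0: "v0 = d"
    using df_eq_0_iff[OF u(1), of "d - v0"] by (simp add: linear_diff[OF linear_df[OF u(1)]])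
  note Vt = Vt[unfolded v0] and Tt = Tt[unfolded v0]
  have "eventually (\<lambda>k. f (w k) /\<^sub>R t k \<noteq> 0) sequentially"
    using tendsto_imp_eventually_ne[OF ft nz(1)] .
  with wD have Nn: "eventually (\<lambda>k. N (w k) \<noteq> 0) sequentially"
    by eventually_elim (use N_nonzero_if_f_nonzero[OF n] in auto)
  have Ttn: "eventually (\<lambda>k. Tt k \<noteq> 0) sequentially"
    using tendsto_imp_eventually_ne[OF Tt nz(1)] .
  define n where "n k = sgn (N (w k))" for k
  have \<nu>: "n \<longlonglongrightarrow> \<nu>" using \<nu> by (simp add: n_def[abs_def] w_def)
  have "eventually (\<lambda>k. norm (n k) = 1) sequentially"
    using Nn by eventually_elim (simp add: n_def norm_sgn)
  then show "norm \<nu> = 1"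
    using tendsto_norm[OF \<nu>] by (rule limit_of_eventually_const[rotated])
  have "(\<lambda>k. n k \<bullet> df (w k) a) \<longlonglongrightarrow> \<nu> \<bullet> df u a"
    by (intro tendsto_inner \<nu> lims(1)[OF tendsto_const])
  moreover have "eventually (\<lambda>k. n k \<bullet> df (w k) a = 0) sequentially"
    using wD by eventually_elim (simp add: n_def sgn_div_norm N_df)
  ultimately show "\<nu> \<bullet> df u a = 0" by (rule limit_of_eventually_const)
  \<comment> \<open>\<open>z\<close> made orthogonal to the tangential part.\<close>
  define z' where "z' k = z - ((df (w k) z \<bullet> Tt k) / (Tt k \<bullet> Tt k)) *\<^sub>R Vt k" for k
  have "z' \<longlonglongrightarrow> z - ((df u z \<bullet> df u d) / (df u d \<bullet> df u d)) *\<^sub>R d"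
    unfolding z'_def[abs_def] using nz
    by (intro tendsto_diff tendsto_scaleR tendsto_divide tendsto_inner Tt Vt lims(1) tendsto_const) auto
  then have z': "z' \<longlonglongrightarrow> z" using dz by (simp add: inner_commute)
  have dz': "eventually (\<lambda>k. w k \<in> D \<and> Tt k \<noteq> 0 \<and> N (w k) \<noteq> 0 \<and> Tt k \<bullet> df (w k) (z' k) = 0) sequentially"
    using wD Ttn Nn
  proof eventually_elim
    case (elim k)
    note L = linear_df[OF elim(1)]
    show ?case
      using elim by (simp add: z'_def linear_diff[OF L] linear_cmul[OF L] inner_diff_right
          Tt_def[symmetric] inner_commute)
  qed
  have dfz': "(\<lambda>k. df (w k) (z' k)) \<longlonglongrightarrow> df u z" by (rule lims(1)[OF z'])
  have z'n: "eventually (\<lambda>k. df (w k) (z' k) \<noteq> 0) sequentially"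
    using tendsto_imp_eventually_ne[OF dfz' nz(2)] .
  have "(\<lambda>k. n k \<bullet> second (w k) (Vt k) (z' k)) \<longlonglongrightarrow> \<nu> \<bullet> second u d z"
    by (intro tendsto_inner \<nu> lims(2) Vt z')
  moreover have "eventually (\<lambda>k. n k \<bullet> second (w k) (Vt k) (z' k) = 0) sequentially"
    using dz'
  proof eventually_elim
    case (elim k)
    then have "N (w k) \<bullet> second (w k) (Vt k) (z' k) = 0"
      by (simp add: N_inner_second TTt Tt_def[symmetric])
    then show ?case by (simp add: n_def sgn_div_norm)
  qed
  ultimately show "\<nu> \<bullet> second u d z = 0" by (rule limit_of_eventually_const)
  define A where "A k = n k \<bullet> second (w k) (Vt k) (Vt k) / (Tt k \<bullet> Tt k) -
    n k \<bullet> second (w k) (z' k) (z' k) / (df (w k) (z' k) \<bullet> df (w k) (z' k))" for k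
  have A: "A \<longlonglongrightarrow> \<nu> \<bullet> second u d d / (df u d \<bullet> df u d) - \<nu> \<bullet> second u z z / (df u z \<bullet> df u z)"
    unfolding A_def[abs_def]
    by (intro tendsto_diff tendsto_divide tendsto_inner \<nu> lims(2) Vt z' Tt dfz') (use nz in auto)
  obtain C e where Ce: "0 < C" "0 < e"
    "\<And>t. 0 < t \<Longrightarrow> t < e \<Longrightarrow> u + t *\<^sub>R d \<in> D \<and> norm (N (u + t *\<^sub>R d)) \<le> C * t^2"
    using norm_N_quadratic[OF u] by metis
  have "eventually (\<lambda>k. t k < e) sequentially" using order_tendstoD(2)[OF t(1) Ce(2)] .
  then have "eventually (\<lambda>k. \<bar>m (w k)\<bar> * (Tt k \<bullet> Tt k) / C \<le> \<bar>A k\<bar>) sequentially"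
    using dz' z'n
  proof eventually_elim
    case (elim k)
    have 1: "N (w k) \<bullet> second (w k) (Vt k) (Vt k) / (Tt k \<bullet> Tt k) =
        \<phi> (w k) - 1 + m (w k) * (t k)^2 * (Tt k \<bullet> Tt k)"
      using elim by (simp add: N_inner_second TTt Tt_def[symmetric] field_simps power2_eq_square)
    have 2: "N (w k) \<bullet> second (w k) (z' k) (z' k) / (df (w k) (z' k) \<bullet> df (w k) (z' k)) = \<phi> (w k) - 1"
      using elim by (simp add: N_inner_second TTt)
    have "A k = (N (w k) \<bullet> second (w k) (Vt k) (Vt k) / (Tt k \<bullet> Tt k) -
        N (w k) \<bullet> second (w k) (z' k) (z' k) / (df (w k) (z' k) \<bullet> df (w k) (z' k))) / norm (N (w k))"
      by (simp add: A_def n_def sgn_div_norm diff_divide_distrib divide_inverse mult.assoc mult.left_commute)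
        (simp add: algebra_simps)
    then have A: "\<bar>A k\<bar> = \<bar>m (w k)\<bar> * (Tt k \<bullet> Tt k) * ((t k)^2 / norm (N (w k)))"
      unfolding 1 2 by (simp add: abs_mult)
    have "norm (N (w k)) \<le> C * (t k)^2" using Ce(3)[OF t(2) elim(1)] by (simp add: w_def)
    then have "1 / C \<le> (t k)^2 / norm (N (w k))"
      using Ce(1) elim by (simp add: field_simps)
    then have "\<bar>m (w k)\<bar> * (Tt k \<bullet> Tt k) * (1 / C) \<le> \<bar>A k\<bar>"
      unfolding A by (intro mult_left_mono) auto
    then show ?case by simp
  qed
  moreover have "(\<lambda>k. \<bar>m (w k)\<bar> * (Tt k \<bullet> Tt k) / C) \<longlonglongrightarrow> \<bar>m u\<bar> * (df u d \<bullet> df u d) / C"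
  proof (intro tendsto_divide tendsto_mult tendsto_rabs tendsto_inner Tt tendsto_const)
    have "isCont m u"
      using smooth_on_continuous[OF smooth_m] open_D u(1) by (simp add: continuous_on_eq_continuous_at)
    then show "(\<lambda>k. m (w k)) \<longlonglongrightarrow> m u" using wu by (rule isCont_tendsto_compose)
  qed (use Ce in auto)
  ultimately have "\<bar>m u\<bar> * (df u d \<bullet> df u d) / C \<le>
      \<bar>\<nu> \<bullet> second u d d / (df u d \<bullet> df u d) - \<nu> \<bullet> second u z z / (df u z \<bullet> df u z)\<bar>"
    by (intro tendsto_le[OF sequentially_bot tendsto_rabs[OF A]])
  moreover have "0 < \<bar>m u\<bar> * (df u d \<bullet> df u d) / C"
    using m_nonzero[OF u(1)] nz Ce(1) by simp
  ultimately show "\<nu> \<bullet> second u d d / (df u d \<bullet> df u d) \<noteq> \<nu> \<bullet> second u z z / (df u z \<bullet> df u z)"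
    by auto
qed

text \<open>The unit sphere is compact, so the unit normals along the ray accumulate.\<close>

lemma exists_blow_up_normal:
  assumes n: "2 \<le> CARD('n)" and u: "u \<in> D" "f u = 0"
    and d: "d \<noteq> 0" and z: "z \<noteq> 0" and dz: "df u d \<bullet> df u z = 0"
  obtains \<nu> where "norm \<nu> = 1" "\<And>a. \<nu> \<bullet> df u a = 0" "\<nu> \<bullet> second u d z = 0"
    "\<nu> \<bullet> second u d d / (df u d \<bullet> df u d) \<noteq> \<nu> \<bullet> second u z z / (df u z \<bullet> df u z)"
proof -
  define s where "s k = sgn (N (u + inverse (real (Suc k)) *\<^sub>R d))" for k
  have "seq_compact (cball (0::'c) 1)"
    using compact_cball compact_eq_seq_compact_metric by blast
  moreover have "\<forall>k. s k \<in> cball 0 1" by (simp add: s_def norm_sgn)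
  ultimately obtain \<nu> r where r: "strict_mono (r :: nat \<Rightarrow> nat)" "(s \<circ> r) \<longlonglongrightarrow> \<nu>"
    by (rule seq_compactE)
  define t where "t k = inverse (real (Suc (r k)))" for k
  have t: "t \<longlonglongrightarrow> 0" "0 < t k" for k
    using LIMSEQ_subseq_LIMSEQ[OF LIMSEQ_inverse_real_of_nat r(1)] by (simp_all add: t_def[abs_def] o_def)
  have \<nu>: "(\<lambda>k. sgn (N (u + t k *\<^sub>R d))) \<longlonglongrightarrow> \<nu>" using r(2) by (simp add: s_def t_def o_def)
  show thesis
    by (rule that) (fact blow_up_second[OF n u d z dz t \<nu>])+
qed

text \<open>For orthonormal \<open>e\<close>, \<open>w\<close> the ray in direction \<open>e\<close> gives \<open>h(e, e) \<noteq> h(w, w)\<close>, the ray in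
  direction \<open>e + w\<close> gives \<open>h(e + w, e - w) = 0\<close>. The two rays may produce opposite limiting normals,
  which does not affect either relation.\<close>

lemma f_nonzero:
  assumes n: "2 \<le> CARD('n)" and codim: "DIM('c) = CARD('n) + 1" and u: "u \<in> D"
  shows "f u \<noteq> 0"
proof
  assume f0: "f u = 0"
  define e0 where "e0 = (axis undefined 1 :: real^'n)"
  obtain w0 where w0: "w0 \<noteq> 0" "(gram u *v e0) \<bullet> w0 = 0"
    using exists_orthogonal_nonzero[OF n] by blast
  have orth0: "df u e0 \<bullet> df u w0 = 0"
    using w0(2) inner_gram[OF u, of w0 e0] by (simp add: inner_commute)
  define e w where "e = e0 /\<^sub>R norm (df u e0)" and "w = w0 /\<^sub>R norm (df u w0)"
  have nz: "df u e0 \<noteq> 0" "df u w0 \<noteq> 0"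
    using df_eq_0_iff[OF u] w0(1) by (auto simp: e0_def axis_eq_0_iff)
  note lin = linear_df[OF u]
  have ee: "df u e \<bullet> df u e = 1" and ww: "df u w \<bullet> df u w = 1" and ew: "df u e \<bullet> df u w = 0"
    using nz orth0 by (simp_all add: e_def w_def linear_cmul[OF lin] dot_square_norm power2_eq_square)
  have en: "e \<noteq> 0" "w \<noteq> 0" using ee ww linear_0[OF lin] by auto
  obtain \<nu> where \<nu>: "norm \<nu> = 1" "\<And>a. \<nu> \<bullet> df u a = 0"
      "\<nu> \<bullet> second u e e \<noteq> \<nu> \<bullet> second u w w"
    using exists_blow_up_normal[OF n u f0 en ew] ee ww by (metis div_by_1)
  have orth: "df u (e + w) \<bullet> df u (e - w) = 0"
    by (simp add: linear_add[OF lin] linear_diff[OF lin] inner_add_left inner_diff_right ee ww ew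
        inner_commute[of "df u w" "df u e"])
  have pm: "e + w \<noteq> 0" "e - w \<noteq> 0"
    using ew ee by (auto simp: add_eq_0_iff2 linear_neg[OF lin])
  obtain \<eta> where \<eta>: "norm \<eta> = 1" "\<And>a. \<eta> \<bullet> df u a = 0" "\<eta> \<bullet> second u (e + w) (e - w) = 0"
    using exists_blow_up_normal[OF n u f0 pm orth] by metis
  have "second u (e + w) (e - w) = second u e e - second u w w"
    by (simp add: linear_add[OF linear_second_left] linear_diff[OF linear_second_right]
        second_commute[OF u, of w e])
  then have "\<eta> \<bullet> (second u e e - second u w w) = 0" using \<eta>(3) by simp
  moreover have "\<nu> = (\<nu> \<bullet> \<eta>) *\<^sub>R \<eta>"
    using normal_line[OF codim u \<eta>(1,2) \<nu>(2)] .
  ultimately have "\<nu> \<bullet> (second u e e - second u w w) = 0"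
    by (metis inner_scaleR_left mult_zero_right)
  then show False using \<nu>(3) by (simp add: inner_diff_right)
qed

lemma N_nonzero:
  assumes "2 \<le> CARD('n)" "DIM('c) = CARD('n) + 1" "u \<in> D"
  shows "N u \<noteq> 0"
  using N_nonzero_if_f_nonzero[OF assms(1,3) f_nonzero[OF assms]] .

end

section \<open>Tangent spaces of immersed hypersurfaces\<close>

text \<open>Here \<open>\<tau>\<close> is a change of parameters that is only known to be continuous. Put
  \<open>s = \<tau>(u + t a) - v\<close>. As \<open>B\<close> is bounded below, \<open>s\<close> is of order \<open>t\<close>; hence the difference quotients of
  \<open>f\<close> in direction \<open>a\<close> differ from \<open>B (s / t)\<close> by a null sequence, and their limit \<open>A a\<close> lies in the
  closed subspace \<open>range B\<close>.\<close>

lemma range_derivative_reparametrization: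
  fixes f :: "'a::euclidean_space \<Rightarrow> 'c::euclidean_space" and h :: "'b::euclidean_space \<Rightarrow> 'c"
  assumes f: "(f has_derivative A) (at u)" and h: "(h has_derivative B) (at v)" and "inj B"
    and E: "open E" "u \<in> E" and \<tau>: "continuous_on E \<tau>" "\<tau> u = v"
    and eq: "\<And>w. w \<in> E \<Longrightarrow> f w = h (\<tau> w)"
  shows "range A \<subseteq> range B"
proof
  fix y assume "y \<in> range A"
  then obtain a where y: "y = A a" by blast
  have linB: "linear B" using h by (rule has_derivative_linear)
  show "y \<in> range B"
  proof (cases "a = 0")
    case True
    then show ?thesis
      using linear_0[OF has_derivative_linear[OF f]] linear_0[OF linB] y by (metis rangeI)
  next
    case False
    obtain c where c: "c > 0" "\<And>s. c * norm s \<le> norm (B s)"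
      using linear_inj_bounded_below_pos[OF linB \<open>inj B\<close>] by metis
    define t where "t k = inverse (real (Suc k))" for k
    have t: "t \<longlonglongrightarrow> 0" "0 < t k" for k
      using LIMSEQ_inverse_real_of_nat by (simp_all add: t_def[abs_def])
    have tn: "t k \<noteq> 0" for k using t(2)[of k] by simp
    define w where "w k = u + t k *\<^sub>R a" for k
    have wu: "w \<longlonglongrightarrow> u"
      unfolding w_def using tendsto_add[OF tendsto_const tendsto_scaleR[OF t(1) tendsto_const[of a]], of u]
      by simp
    have wE: "eventually (\<lambda>k. w k \<in> E) sequentially"
      using topological_tendstoD[OF wu E] .
    define s where "s k = \<tau> (w k) - v" for k
    have "isCont \<tau> u" using \<tau>(1) E by (simp add: continuous_on_eq_continuous_at)
    then have "(\<lambda>k. \<tau> (w k)) \<longlonglongrightarrow> \<tau> u" using wu by (rule isCont_tendsto_compose)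
    then have s: "s \<longlonglongrightarrow> 0" unfolding s_def[abs_def] \<tau>(2) by (rule LIM_zero)
    define q where "q k = (f (w k) - f u) /\<^sub>R t k" for k
    have q: "q \<longlonglongrightarrow> A a"
      unfolding q_def[abs_def] w_def using tendsto_difference_quotient[OF f False t(1) tn] .
    have fu: "f u = h v" using eq[OF E(2)] \<tau>(2) by simp
    have "(\<lambda>k. B (s k /\<^sub>R t k)) \<longlonglongrightarrow> A a"
    proof -
      have "(\<lambda>k. q k - B (s k /\<^sub>R t k)) \<longlonglongrightarrow> 0"
      proof (rule LIMSEQ_I)
        fix r :: real assume "0 < r"
        define K where "K = norm (A a) + 1"
        have K: "K > 0" by (simp add: K_def add_nonneg_pos)
        define e where "e = min (c / 2) (r * c / (4 * K))"
        \<comment> \<open>The first bound makes \<open>s\<close> of order \<open>t\<close>, with constant \<open>2 K / c\<close>; the second makes the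
          resulting error smaller than \<open>r\<close>.\<close>
        have e: "e > 0" "e \<le> c / 2" "e * (2 / c * K) < r"
        proof -
          show "e > 0" "e \<le> c / 2" using c K \<open>0 < r\<close> by (simp_all add: e_def)
          have "e * (2 / c * K) \<le> (r * c / (4 * K)) * (2 / c * K)"
            using c K by (intro mult_right_mono) (simp_all add: e_def)
          also have "\<dots> < r" using c K \<open>0 < r\<close> by (simp add: field_simps)
          finally show "e * (2 / c * K) < r" .
        qed
        obtain d where d: "d > 0"
          "\<And>y. norm (y - v) < d \<Longrightarrow> norm (h y - h v - B (y - v)) \<le> e * norm (y - v)"
          using h e(1) unfolding has_derivative_at_alt by metis
        have "eventually (\<lambda>k. norm (s k) < d) sequentially"
          using order_tendstoD(2)[OF tendsto_norm[OF s], of d] d(1) by simp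
        moreover have "eventually (\<lambda>k. norm (q k) < K) sequentially"
          by (rule order_tendstoD(2)[OF tendsto_norm[OF q]]) (simp add: K_def)
        ultimately have "eventually (\<lambda>k. norm (q k - B (s k /\<^sub>R t k) - 0) < r) sequentially"
          using wE
        proof eventually_elim
          case (elim k)
          let ?R = "h (\<tau> (w k)) - h v - B (s k)"
          have R: "norm ?R \<le> e * norm (s k)" using d(2)[of "\<tau> (w k)"] elim(1) by (simp add: s_def)
          have hq: "h (\<tau> (w k)) - h v = t k *\<^sub>R q k"
            using eq[OF elim(3)] fu tn[of k] by (simp add: q_def)
          have "c * norm (s k) \<le> norm (t k *\<^sub>R q k - ?R)" using c(2)[of "s k"] by (simp add: hq)
          also have "\<dots> \<le> t k * norm (q k) + e * norm (s k)"
            using norm_triangle_ineq4[of "t k *\<^sub>R q k" ?R] R t(2)[of k] by simp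
          also have "\<dots> \<le> t k * norm (q k) + (c / 2) * norm (s k)"
            using e(2) by (intro add_left_mono mult_right_mono) auto
          finally have "(c / 2) * norm (s k) \<le> t k * norm (q k)" by (simp add: algebra_simps)
          also have "\<dots> \<le> t k * K" using elim(2) t(2)[of k] by (intro mult_left_mono) auto
          finally have "norm (s k) \<le> t k * (2 / c * K)" using c(1) by (simp add: field_simps)
          then have "norm ?R \<le> e * (t k * (2 / c * K))"
            using R e(1) by (meson mult_left_mono less_imp_le order_trans)
          then have R': "norm ?R \<le> t k * (e * (2 / c * K))" by (simp add: mult.left_commute)
          have "q k - B (s k /\<^sub>R t k) = ?R /\<^sub>R t k"
            using tn[of k] by (simp add: hq linear_cmul[OF linB] scaleR_right_diff_distrib)
          then have "norm (q k - B (s k /\<^sub>R t k)) = norm ?R / t k"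
            using t(2)[of k] by (simp add: divide_inverse mult.commute)
          also have "\<dots> \<le> e * (2 / c * K)"
            using R' t(2)[of k] by (simp add: pos_divide_le_eq mult.commute)
          finally show ?case using e(3) by simp
        qed
        then show "\<exists>no. \<forall>k\<ge>no. norm (q k - B (s k /\<^sub>R t k) - 0) < r"
          by (simp add: eventually_sequentially)
      qed
      from tendsto_diff[OF q this] show ?thesis by simp
    qed
    moreover have "closed (range B)"
      by (rule closed_subspace) (rule linear_subspace_image[OF linB subspace_UNIV])
    ultimately show ?thesis
      unfolding y using closed_sequentially[of "range B" "\<lambda>k. B (s k /\<^sub>R t k)" "A a"] by blast
  qed
qed

lemma param_atD:
  assumes "param_at M x p D \<psi> u"
  shows "local_param M x D \<psi>" "u \<in> D" "\<psi> u = p"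
  using assms by (auto simp: param_at_def)

lemma param_atI: "local_param M x D \<psi> \<Longrightarrow> u \<in> D \<Longrightarrow> param_at M x (\<psi> u) D \<psi> u"
  by (simp add: param_at_def)

lemma local_param_image: "local_param M x D \<psi> \<Longrightarrow> u \<in> D \<Longrightarrow> \<psi> u \<in> M"
  unfolding local_param_def by (meson image_eqI openin_imp_subset subsetD)

lemma local_param_immersed: "local_param M x D \<psi> \<Longrightarrow> immersed_patch (x \<circ> \<psi>) D"
  by (simp add: local_param_def immersed_patch_def)

lemma range_derivative_param:
  assumes 1: "param_at M x p D \<psi> u" and 2: "param_at M x p E \<theta> v"
  shows "range (frechet_derivative (x \<circ> \<psi>) (at u)) \<subseteq> range (frechet_derivative (x \<circ> \<theta>) (at v))"
proof -
  interpret P: immersed_patch "x \<circ> \<psi>" D using 1 by (blast dest: param_atD local_param_immersed)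
  interpret Q: immersed_patch "x \<circ> \<theta>" E using 2 by (blast dest: param_atD local_param_immersed)
  obtain \<psi>' where \<psi>': "homeomorphism D (\<psi> ` D) \<psi> \<psi>'"
    using param_atD(1)[OF 1] by (auto simp: local_param_def)
  obtain \<theta>' where \<theta>': "homeomorphism E (\<theta> ` E) \<theta> \<theta>'"
    using param_atD(1)[OF 2] by (auto simp: local_param_def)
  have opn: "openin (top_of_set M) (\<theta> ` E)"
    using param_atD(1)[OF 2] by (auto simp: local_param_def)
  let ?W = "D \<inter> \<psi> -` (\<theta> ` E)"
  have cont: "continuous_on D \<psi>" using \<psi>' by (simp add: homeomorphism_def)
  have "openin (top_of_set D) ?W"
    using param_atD(1)[OF 1] by (intro continuous_openin_preimage[OF cont _ opn]) (auto intro: local_param_image)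
  then have W: "open ?W" using P.open_D by (simp add: openin_open_eq)
  show ?thesis
  proof (rule range_derivative_reparametrization[where \<tau> = "\<theta>' \<circ> \<psi>", OF _ _ _ W])
    show "(x \<circ> \<psi> has_derivative frechet_derivative (x \<circ> \<psi>) (at u)) (at u)"
      by (rule has_derivative_frechet[OF P.differentiable_f[OF param_atD(2)[OF 1]]])
    show "(x \<circ> \<theta> has_derivative frechet_derivative (x \<circ> \<theta>) (at v)) (at v)"
      by (rule has_derivative_frechet[OF Q.differentiable_f[OF param_atD(2)[OF 2]]])
    show "inj (frechet_derivative (x \<circ> \<theta>) (at v))"
      by (rule Q.inj_df[OF param_atD(2)[OF 2]])
    show "u \<in> ?W"
      using param_atD[OF 1] param_atD[OF 2] by (metis IntI imageI vimageI)
    have "continuous_on (\<theta> ` E) \<theta>'" using \<theta>' by (simp add: homeomorphism_def)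
    then show "continuous_on ?W (\<theta>' \<circ> \<psi>)"
      by (intro continuous_on_compose continuous_on_subset[OF cont]) (auto elim: continuous_on_subset)
    show "(\<theta>' \<circ> \<psi>) u = v"
      using param_atD[OF 1] param_atD[OF 2] \<theta>' by (auto simp: homeomorphism_def)
    show "(x \<circ> \<psi>) w = (x \<circ> \<theta>) ((\<theta>' \<circ> \<psi>) w)" if "w \<in> ?W" for w
      using that \<theta>' by (auto simp: homeomorphism_def)
  qed
qed

lemma tangent_space_param:
  assumes "param_at M x p D \<psi> u"
  shows "tangent_space M x p = range (frechet_derivative (x \<circ> \<psi>) (at u))"
  using range_derivative_param[OF _ assms] assms unfolding tangent_space_def by blast

lemma metric_matrix_gram: "metric_matrix x induced_metric \<psi> = immersed_patch.gram (x \<circ> \<psi>)"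
  if "immersed_patch (x \<circ> \<psi>) D"
  unfolding immersed_patch.gram_def[OF that, abs_def]
  by (simp add: metric_matrix_def[abs_def] induced_metric_def)

lemma tangential_part_param:
  fixes x :: "'m::topological_space \<Rightarrow> real^('n::finite + 1)"
  assumes "param_at M x p D \<psi> u"
  shows "tangential_part M x p \<in> range (frechet_derivative (x \<circ> \<psi>) (at u))"
    and "(x p - tangential_part M x p) \<bullet> frechet_derivative (x \<circ> \<psi>) (at u) a = 0"
proof -
  interpret immersed_patch "x \<circ> \<psi>" D
    using assms by (blast dest: param_atD local_param_immersed)
  let ?S = "range (df u)"
  have lin: "linear (df u)" by (rule linear_df[OF param_atD(2)[OF assms]])
  have sub: "subspace ?S" by (rule linear_subspace_image[OF lin subspace_UNIV])
  have span: "span ?S = ?S" using sub by (rule span_eq_iff[THEN iffD2])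
  obtain y z where yz: "y \<in> ?S" "\<And>w. w \<in> ?S \<Longrightarrow> orthogonal z w" "x p = y + z"
    using orthogonal_subspace_decomp_exists[of ?S "x p"] unfolding span by metis
  let ?P = "\<lambda>y. y \<in> ?S \<and> (\<forall>v\<in>?S. (x p - y) \<bullet> v = 0)"
  have "?P y" using yz by (auto simp: orthogonal_def)
  moreover have "y' = y''" if "?P y'" "?P y''" for y' y''
  proof -
    have "y' - y'' \<in> ?S" using that sub by (blast intro: subspace_diff)
    then have "(x p - y'') \<bullet> (y' - y'') = 0" "(x p - y') \<bullet> (y' - y'') = 0" using that by auto
    then have "(y' - y'') \<bullet> (y' - y'') = 0" by (simp add: inner_diff_left)
    then show ?thesis by simp
  qed
  ultimately have "\<exists>!y. ?P y" by blast
  from theI'[OF this] have "?P (tangential_part M x p)"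
    unfolding tangential_part_def tangent_space_param[OF assms] .
  then show "tangential_part M x p \<in> ?S" "(x p - tangential_part M x p) \<bullet> df u a = 0" by auto
qed

lemma derivative_coord_field:
  assumes "param_at M x p D \<psi> u"
  shows "frechet_derivative (x \<circ> \<psi>) (at u) (coord_field x \<psi> (tangential_part M x) u) = tangential_part M x p"
proof -
  interpret immersed_patch "x \<circ> \<psi>" D
    using assms by (blast dest: param_atD local_param_immersed)
  have "\<exists>!a. df u a = tangential_part M x p"
  proof (rule ex_ex1I)
    show "\<exists>a. df u a = tangential_part M x p"
      using tangential_part_param(1)[OF assms] by (auto simp: image_iff)
    show "a = b" if "df u a = tangential_part M x p" "df u b = tangential_part M x p" for a b
      using injD[OF inj_df[OF param_atD(2)[OF assms]], of a b] that by simp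
  qed
  from theI'[OF this] show ?thesis
    by (simp add: coord_field_def param_atD(3)[OF assms])
qed

lemma unit_normal_exists:
  fixes x :: "'m::topological_space \<Rightarrow> real^('n::finite + 1)"
  assumes "param_at M x p D \<psi> u"
  obtains \<nu> where "unit_normal M x p \<nu>"
proof -
  interpret immersed_patch "x \<circ> \<psi>" D
    using assms by (blast dest: param_atD local_param_immersed)
  have "dim (range (df u)) \<le> dim (UNIV :: (real^'n) set)"
    by (rule dim_image_le[OF linear_df[OF param_atD(2)[OF assms]]])
  then have "dim (range (df u)) < DIM(real^('n + 1))" by (simp add: dim_UNIV)
  then obtain y where y: "y \<noteq> 0" "\<And>v. v \<in> span (range (df u)) \<Longrightarrow> orthogonal y v"
    using orthogonal_to_subspace_exists by blast
  have "unit_normal M x p (sgn y)"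
    unfolding unit_normal_def tangent_space_param[OF assms]
    using y by (auto simp: norm_sgn sgn_div_norm orthogonal_def span_base)
  then show thesis by (rule that)
qed

section \<open>Solitons with the tangential position vector as soliton field\<close>

locale position_soliton =
  fixes M :: "'m::{t2_space,second_countable_topology} set"
    and x :: "'m \<Rightarrow> real^('n::finite + 1)" and l :: real and \<mu> :: "'m \<Rightarrow> real"
  assumes soliton: "quasi_yamabe_soliton M x induced_metric (tangential_part M x) l \<mu>"
    and \<mu>_nonzero: "p \<in> M \<Longrightarrow> \<mu> p \<noteq> 0"
begin

abbreviation (input) V where "V \<psi> \<equiv> coord_field x \<psi> (tangential_part M x)"

abbreviation (input) \<Phi> where "\<Phi> \<equiv> \<lambda>p. scalar_curvature M x induced_metric p - l"

lemma soliton_patch_param: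
  assumes "local_param M x D \<psi>"
  shows "soliton_patch (x \<circ> \<psi>) D (V \<psi>) (\<lambda>u. \<Phi> (\<psi> u)) (\<mu> \<circ> \<psi>)"
proof -
  interpret immersed_patch "x \<circ> \<psi>" D using assms by (rule local_param_immersed)
  have par: "param_at M x (\<psi> u) D \<psi> u" if "u \<in> D" for u
    using assms that by (rule param_atI)
  show ?thesis
  proof unfold_locales
    show "smooth_on D (V \<psi>)"
      using soliton assms by (simp add: quasi_yamabe_soliton_def vector_field_def)
    show "((x \<circ> \<psi>) u - df u (V \<psi> u)) \<bullet> df u a = 0" if "u \<in> D" for u a
      using tangential_part_param(2)[OF par[OF that], of a] derivative_coord_field[OF par[OF that]]
      by simp
    show "(1/2) * lie_deriv_metric (V \<psi>) gram u $ i $ j = \<Phi> (\<psi> u) * gram u $ i $ j +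
        (\<mu> \<circ> \<psi>) u * ((gram u *v V \<psi> u) $ i * (gram u *v V \<psi> u) $ j)" if "u \<in> D" for u i j
      using soliton par[OF that] local_param_image[OF assms that]
      unfolding quasi_yamabe_soliton_def Let_def
        metric_matrix_gram[OF immersed_patch_axioms, symmetric] o_apply
      by blast
    show "smooth_on D (\<mu> \<circ> \<psi>)"
      using soliton assms by (simp add: quasi_yamabe_soliton_def smooth_fun_def)
    show "(\<mu> \<circ> \<psi>) u \<noteq> 0" if "u \<in> D" for u
      using \<mu>_nonzero local_param_image[OF assms that] by simp
  qed
qed

text \<open>In codimension one \<open>N = \<rho> \<nu>\<close>, with \<open>\<rho> \<noteq> 0\<close> because \<open>N\<close> vanishes nowhere; dividing the equation
  for \<open>\<langle>N, h\<rangle>\<close> by \<open>\<rho>\<close> and raising an index gives the shape operator.\<close>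

lemma shape_operator_rank_one:
  assumes n: "2 \<le> CARD('n)" and par: "param_at M x p D \<psi> u" and \<nu>: "unit_normal M x p \<nu>"
  obtains \<kappa> \<sigma> b where "scalar_plus_rank_one (shape_operator x \<psi> \<nu> u) \<kappa> \<sigma> b (V \<psi> u)" "\<sigma> \<noteq> 0"
    "tangential_part M x p \<noteq> 0 \<Longrightarrow> b \<bullet> V \<psi> u \<noteq> 0"
    "V \<psi> u = 0 \<longleftrightarrow> tangential_part M x p = 0"
proof -
  interpret soliton_patch "x \<circ> \<psi>" D "V \<psi>" "\<lambda>u. \<Phi> (\<psi> u)" "\<mu> \<circ> \<psi>"
    using soliton_patch_param[OF param_atD(1)[OF par]] .
  have u: "u \<in> D" using param_atD(2)[OF par] .
  have T: "T u = tangential_part M x p"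
    using derivative_coord_field[OF par] by (simp add: T_def)
  have codim: "DIM(real^('n + 1)) = CARD('n) + 1" by simp
  have \<nu>: "norm \<nu> = 1" "\<nu> \<bullet> df u a = 0" for a
    using \<nu> by (auto simp: unit_normal_def tangent_space_param[OF par])
  define \<rho> where "\<rho> = N u \<bullet> \<nu>"
  have N: "N u = \<rho> *\<^sub>R \<nu>"
    unfolding \<rho>_def using normal_line[OF codim u \<nu> N_df[OF u]] .
  then have \<rho>: "\<rho> \<noteq> 0" using N_nonzero[OF n codim u] by auto
  define c where "c = \<Phi> (\<psi> u) - 1"
  define b where "b = gram u *v V \<psi> u"
  have b: "b \<bullet> w = T u \<bullet> df u w" for w
    using inner_gram[OF u, of w "V \<psi> u"] by (simp add: b_def T_def inner_commute)
  have A: "shape_operator x \<psi> \<nu> u *v w = (c / \<rho>) *\<^sub>R w + (\<mu> p / \<rho> * (b \<bullet> w)) *\<^sub>R V \<psi> u" for w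
  proof -
    let ?A = "shape_operator x \<psi> \<nu> u"
    have gA: "gram u *v (?A *v w) = second_fundamental_form x \<psi> \<nu> u *v w"
      unfolding shape_operator_def metric_matrix_gram[OF immersed_patch_axioms]
      by (simp add: matrix_vector_mul_assoc[symmetric] gram_inverse_mult[OF u])
    have "gram u *v (\<rho> *\<^sub>R (?A *v w)) = gram u *v (c *\<^sub>R w + (\<mu> p * (b \<bullet> w)) *\<^sub>R V \<psi> u)"
    proof (rule vec_eq_iff[THEN iffD2], rule allI)
      fix i
      have "(gram u *v (\<rho> *\<^sub>R (?A *v w))) $ i = (\<Sum>j\<in>UNIV. (N u \<bullet> pd i (pd j (x \<circ> \<psi>)) u) * w $ j)"
        by (simp add: matrix_vector_mult_scaleR gA N)
          (simp add: matrix_vector_mult_def second_fundamental_form_def sum_distrib_left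
            inner_commute mult.assoc)
      also have "\<dots> = N u \<bullet> second u (axis i 1) w"
        by (simp add: second_axis inner_sum_right mult.commute)
      also have "\<dots> = c * (pd i (x \<circ> \<psi>) u \<bullet> df u w) + \<mu> p * ((T u \<bullet> pd i (x \<circ> \<psi>) u) * (T u \<bullet> df u w))"
        by (simp add: N_inner_second[OF u] df_pd c_def param_atD(3)[OF par])
      also have "\<dots> = (gram u *v (c *\<^sub>R w + (\<mu> p * (b \<bullet> w)) *\<^sub>R V \<psi> u)) $ i"
        by (simp add: matrix_vector_right_distrib matrix_vector_mult_scaleR gram_V[OF u])
          (simp add: gram_mult[OF u] b inner_commute)
      finally show "(gram u *v (\<rho> *\<^sub>R (?A *v w))) $ i =
        (gram u *v (c *\<^sub>R w + (\<mu> p * (b \<bullet> w)) *\<^sub>R V \<psi> u)) $ i" .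
    qed
    from gram_cancel[OF u this]
    have "(1 / \<rho>) *\<^sub>R (\<rho> *\<^sub>R (?A *v w)) = (1 / \<rho>) *\<^sub>R (c *\<^sub>R w + (\<mu> p * (b \<bullet> w)) *\<^sub>R V \<psi> u)"
      by simp
    then show ?thesis using \<rho> by (simp add: scaleR_add_right)
  qed
  show thesis
  proof (rule that[of "c / \<rho>" "\<mu> p / \<rho>" b])
    show "scalar_plus_rank_one (shape_operator x \<psi> \<nu> u) (c / \<rho>) (\<mu> p / \<rho>) b (V \<psi> u)"
      using A by unfold_locales
    show "\<mu> p / \<rho> \<noteq> 0" using \<rho> m_nonzero[OF u] param_atD(3)[OF par] by simp
    show "tangential_part M x p \<noteq> 0 \<Longrightarrow> b \<bullet> V \<psi> u \<noteq> 0"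
      by (simp add: b T flip: T_def)
    show "V \<psi> u = 0 \<longleftrightarrow> tangential_part M x p = 0"
      using T_eq_0_iff[OF u] T by simp
  qed
qed

lemma torse_forming_position: "torse_forming M x induced_metric (tangential_part M x)"
  unfolding torse_forming_def
proof (intro conjI exI)
  let ?\<alpha> = "\<lambda>p v. \<mu> p * (tangential_part M x p \<bullet> v)"
  show "vector_field M x (tangential_part M x)"
    using soliton by (simp add: quasi_yamabe_soliton_def)
  show "smooth_fun M x \<Phi>"
    unfolding smooth_fun_def comp_def
    using soliton_patch.smooth_\<phi>[OF soliton_patch_param] by blast
  show "one_form M x ?\<alpha>"
    unfolding one_form_def
  proof (intro conjI allI impI)
    show "\<forall>p\<in>M. \<forall>v\<in>tangent_space M x p. \<forall>w\<in>tangent_space M x p. \<forall>a b.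
        ?\<alpha> p (a *\<^sub>R v + b *\<^sub>R w) = a * ?\<alpha> p v + b * ?\<alpha> p w"
      by (simp add: inner_add_right algebra_simps)
    fix D \<psi> i assume lp: "local_param M x D \<psi>"
    interpret soliton_patch "x \<circ> \<psi>" D "V \<psi>" "\<lambda>u. \<Phi> (\<psi> u)" "\<mu> \<circ> \<psi>"
      using soliton_patch_param[OF lp] .
    have "smooth_on D (\<lambda>u. (\<mu> \<circ> \<psi>) u * (gram u *v V \<psi> u) $ i)"
      by (intro smooth_on_mult open_D smooth_m smooth_gram_V)
    then show "smooth_on D (\<lambda>u. ?\<alpha> (\<psi> u) (pd i (x \<circ> \<psi>) u))"
    proof (rule smooth_on_cong[OF open_D, rotated])
      fix u assume u: "u \<in> D"
      show "(\<mu> \<circ> \<psi>) u * (gram u *v V \<psi> u) $ i = ?\<alpha> (\<psi> u) (pd i (x \<circ> \<psi>) u)"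
        using gram_V[OF u] derivative_coord_field[OF param_atI[OF lp u]]
        by (simp add: T_def inner_commute)
    qed
  qed
  show "\<forall>p\<in>M. \<forall>D \<psi> u a. param_at M x p D \<psi> u \<longrightarrow>
      cov_deriv (metric_matrix x induced_metric \<psi>) (V \<psi>) u a =
        \<Phi> p *\<^sub>R a + ?\<alpha> p (frechet_derivative (x \<circ> \<psi>) (at u) a) *\<^sub>R V \<psi> u"
  proof (intro ballI allI impI)
    fix p D \<psi> u a assume par: "param_at M x p D \<psi> u"
    interpret soliton_patch "x \<circ> \<psi>" D "V \<psi>" "\<lambda>u. \<Phi> (\<psi> u)" "\<mu> \<circ> \<psi>"
      using soliton_patch_param[OF param_atD(1)[OF par]] .
    show "cov_deriv (metric_matrix x induced_metric \<psi>) (V \<psi>) u a =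
        \<Phi> p *\<^sub>R a + ?\<alpha> p (df u a) *\<^sub>R V \<psi> u"
      using cov_deriv_V[OF param_atD(2)[OF par], of a] derivative_coord_field[OF par]
      by (simp add: metric_matrix_gram[OF immersed_patch_axioms] T_def param_atD(3)[OF par])
  qed
qed

lemma quasi_umbilical_position: "quasi_umbilical M x"
  unfolding quasi_umbilical_def
proof (intro ballI allI impI, elim conjE)
  fix p D \<psi> u \<nu> assume par: "param_at M x p D \<psi> u" and \<nu>: "unit_normal M x p \<nu>"
  show "\<exists>\<kappa>. eigenvalue (shape_operator x \<psi> \<nu> u) \<kappa> \<and>
      CARD('n) - 1 \<le> eig_mult (shape_operator x \<psi> \<nu> u) \<kappa>"
  proof (cases "2 \<le> CARD('n)")
    case True
    then obtain \<kappa> \<sigma> b where "scalar_plus_rank_one (shape_operator x \<psi> \<nu> u) \<kappa> \<sigma> b (V \<psi> u)"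
      using shape_operator_rank_one[OF _ par \<nu>] by metis
    then show ?thesis
      using scalar_plus_rank_one.eig_mult_ge scalar_plus_rank_one.eigenvalue_scalar True by blast
  next
    case False
    then have "CARD('n) = 1"
      using zero_less_card_finite[where 'a='n] by linarith
    then show ?thesis using eigenvalue_exists_dim_1 by auto
  qed
qed

lemma tangential_part_nonzero_in_locus:
  assumes "2 \<le> CARD('n)" "p \<in> M" "tangential_part M x p \<noteq> 0"
  shows "p \<in> quasi_umbilical_locus M x"
proof -
  have "\<exists>\<kappa>. eigenvalue (shape_operator x \<psi> \<nu> u) \<kappa> \<and>
      eig_mult (shape_operator x \<psi> \<nu> u) \<kappa> = CARD('n) - 1"
    if par: "param_at M x p D \<psi> u" and \<nu>: "unit_normal M x p \<nu>" for D \<psi> u \<nu>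
  proof -
    obtain \<kappa> \<sigma> b where "scalar_plus_rank_one (shape_operator x \<psi> \<nu> u) \<kappa> \<sigma> b (V \<psi> u)" "\<sigma> \<noteq> 0"
      "b \<bullet> V \<psi> u \<noteq> 0"
      using shape_operator_rank_one[OF assms(1) par \<nu>] assms(3) by metis
    then show ?thesis
      using scalar_plus_rank_one.eig_mult_scalar scalar_plus_rank_one.eigenvalue_scalar assms(1) by blast
  qed
  then show ?thesis using assms(2) by (auto simp: quasi_umbilical_locus_def)
qed

text \<open>The locus is empty for curves. In higher dimension the shape operator is a multiple of the
  identity wherever the tangential part vanishes, so such points do not belong to the locus.\<close>

lemma distinguished_direction_position:
  assumes "hypersurface M x"
  shows "distinguished_direction M x (tangential_part M x)"
  unfolding distinguished_direction_def
proof (intro ballI)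
  fix p assume p: "p \<in> quasi_umbilical_locus M x"
  then obtain D \<psi> u where par: "param_at M x p D \<psi> u"
    using assms by (auto simp: hypersurface_def quasi_umbilical_locus_def)
  obtain \<nu> where \<nu>: "unit_normal M x p \<nu>" using unit_normal_exists[OF par] .
  obtain k where k: "eigenvalue (shape_operator x \<psi> \<nu> u) k"
    "eig_mult (shape_operator x \<psi> \<nu> u) k = CARD('n) - 1"
    using p par \<nu> unfolding quasi_umbilical_locus_def by blast
  have n: "2 \<le> CARD('n)" using eig_mult_pos[OF k(1)] k(2) by linarith
  have T: "tangential_part M x p \<noteq> 0"
  proof
    assume 0: "tangential_part M x p = 0"
    obtain \<kappa> \<sigma> b where "scalar_plus_rank_one (shape_operator x \<psi> \<nu> u) \<kappa> \<sigma> b (V \<psi> u)" "V \<psi> u = 0"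
      using shape_operator_rank_one[OF n par \<nu>] 0 by metis
    from scalar_plus_rank_one.eig_mult_umbilical[OF this k(1)] show False using k(2) n by simp
  qed
  have "\<exists>\<kappa>. shape_operator x \<psi> \<nu> u *v V \<psi> u = \<kappa> *\<^sub>R V \<psi> u \<and>
      eig_mult (shape_operator x \<psi> \<nu> u) \<kappa> = 1"
    if par: "param_at M x p D \<psi> u" and \<nu>: "unit_normal M x p \<nu>" for D \<psi> u \<nu>
  proof -
    obtain \<kappa> \<sigma> b where "scalar_plus_rank_one (shape_operator x \<psi> \<nu> u) \<kappa> \<sigma> b (V \<psi> u)" "\<sigma> \<noteq> 0"
      "b \<bullet> V \<psi> u \<noteq> 0"
      using shape_operator_rank_one[OF n par \<nu>] T by metis
    then show ?thesis
      using scalar_plus_rank_one.eig_mult_direction scalar_plus_rank_one.mult_direction by blast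
  qed
  then show "tangential_part M x p \<in> tangent_space M x p \<and> tangential_part M x p \<noteq> 0 \<and>
      (\<forall>D \<psi> u \<nu>. param_at M x p D \<psi> u \<and> unit_normal M x p \<nu> \<longrightarrow>
        (\<exists>\<kappa>. shape_operator x \<psi> \<nu> u *v V \<psi> u = \<kappa> *\<^sub>R V \<psi> u \<and>
             eig_mult (shape_operator x \<psi> \<nu> u) \<kappa> = 1))"
    using T tangential_part_param(1)[OF par] unfolding tangent_space_param[OF par] by blast
qed

end

theorem theorem4p2:
  fixes M :: "'m::{t2_space,second_countable_topology} set"
    and x :: "'m \<Rightarrow> real^('n::finite + 1)"
    and l :: real
    and \<mu> :: "'m \<Rightarrow> real"
  assumes "hypersurface M x"
    and "proper_submanifold M x"
    and "quasi_yamabe_soliton M x induced_metric (tangential_part M x) l \<mu>"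
    and "\<forall>p\<in>M. \<mu> p \<noteq> 0"
  shows "quasi_umbilical M x
    \<and> distinguished_direction M x (tangential_part M x)
    \<and> (CARD('n) \<ge> 2 \<longrightarrow> M \<subseteq> closure (quasi_umbilical_locus M x))
    \<and> torse_forming M x induced_metric (tangential_part M x)"
proof -
  interpret position_soliton M x l \<mu> using assms(3,4) by unfold_locales auto
  have "M \<subseteq> closure (quasi_umbilical_locus M x)" if "2 \<le> CARD('n)"
  proof -
    obtain W where W: "openin (top_of_set M) W" "M \<subseteq> closure W"
      "\<And>p. p \<in> W \<Longrightarrow> tangential_part M x p \<noteq> 0"
      using assms(2) unfolding proper_submanifold_def by blast
    have "W \<subseteq> quasi_umbilical_locus M x"
      using W(3) openin_imp_subset[OF W(1)] tangential_part_nonzero_in_locus[OF that] by blast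
    then show ?thesis using W(2) closure_mono by blast
  qed
  then show ?thesis
    using quasi_umbilical_position distinguished_direction_position[OF assms(1)]
      torse_forming_position by blast
qed

end
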